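(* Consider iterates $x^k=[(x_1^k)^T,\dots,(x_m^k)^T]^T\in\mathbb{R}^{md}$ generated by algorithm PDG-NDS: $x^0$ is arbitrary, $x^1=(W\otimes I_d)x^0-(\Lambda^0\otimes I_d)g^0$, and for $k\ge0$ $$x^{k+2}=2(W\otimes I_d)x^{k+1}-(W^2\otimes I_d)x^k-\left(\left((B^k\Lambda^{k+1})\otimes I_d\right)g^{k+1}-\left((B^k\Lambda^k)\otimes I_d\right)g^k\right).$$ Suppose that $W=\{w_{ij}\}\in\mathbb{R}^{m\times m}$ satisfies $\mathbf{1}^TW=\mathbf{1}^T$, $W\mathbf{1}=\mathbf{1}$ and $\eta=\|W-\frac{\mathbf{1}\mathbf{1}^T}{m}\|<1$. Suppose that the problem $\min_{\theta\in\mathbb{R}^d}F(\theta)$, $F=\frac1m\sum_{i=1}^mf_i$, has at least one optimal solution $\theta^*$, and that every $f_i:\mathbb{R}^d\to\mathbb{R}$ is convex with $\|\nabla f_i(u)-\nabla f_i(v)\|\le L\|u-v\|$ for all $i$ and all $u,v\in\mathbb{R}^d$, for some $L>0$. Suppose there exist $T\ge0$, $\delta\in(0,1)$ and $c\in(0,1)$ such that the stepsize vectors $\lambda^k=[\lambda_1^k,\dots,\lambda_m^k]^T$ (with all elements nonnegative) satisfy $$\sum_{k=T}^\infty\bar\lambda^k=\infty,\qquad \sum_{k=T}^\infty\|\lambda^{k+1}-\lambda^k\|^2<\infty,\qquad \sum_{k=T}^\infty\frac{\|\lambda^k-\bar\lambda^k\mathbf{1}\|^2}{\bar\lambda^k}<\infty,$$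 and, for all $k\ge T$, $$\frac{2L}{m\bar\lambda^k}(\lambda_{\max}^k)^2\le1-\eta,\qquad \bar\lambda^kL\le\frac{\delta}{1+\delta},\qquad \eta+\frac{6m^2L^2}{1-\eta}\|\lambda^{k+1}\|^2\le c,$$ $$\max\{m^3r^2,m^2\}\,6L^2\|\lambda^{k+1}\|^2\le(1-\eta)^3(1-c)(1-\delta).$$ Then: (a) $\lim_{k\to\infty}F(\bar x^k)$ exists, and $\lim_{k\to\infty}\|\bar y^k\|=\lim_{k\to\infty}\|x_i^k-\bar x^k\|=\lim_{k\to\infty}\|y_i^k-\bar y^k\|=0$ for all $i$. (b) $\lim_{k\to\infty}\|\nabla F(\bar x^k)\|=0$. Moreover, if $\{\bar x^k\}$ is bounded, then every accumulation point of $\{\bar x^k\}$ is an optimal solution, and $\lim_{k\to\infty}F(x_i^k)=F(\theta^* )$ for all $i$.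
   Context: There are $m$ agents on an undirected graph described by the nonnegative weight matrix $W$: $w_{ij}>0$ if agents $i$ and $j$ can interact, $w_{ij}=0$ otherwise, $w_{ii}>0$. In PDG-NDS, $g^k=[(g_1^k)^T,\dots,(g_m^k)^T]^T$ with $g_i^k=\nabla f_i(x_i^k)$; $\Lambda^k=\mathrm{diag}[\lambda_1^k,\dots,\lambda_m^k]$, with $\lambda_i^k\ge0$ the stepsize of agent $i$ at iteration $k$; and each $B^k\in\mathbb{R}^{m\times m}$ is column-stochastic (nonnegative entries, each column sums to one). Notation: $\bar\lambda^k=\frac1m\sum_{i=1}^m\lambda_i^k$, $\lambda_{\max}^k=\max_i\lambda_i^k$, $r=\|W-I\|$; the auxiliary variable is $y^k=[(y_1^k)^T,\dots,(y_m^k)^T]^T=(W\otimes I_d)x^k-x^{k+1}$; $\bar x^k=\frac1m\sum_{i=1}^mx_i^k$ and $\bar y^k=\frac1m\sum_{i=1}^my_i^k$. $\mathbf{1}$ is the all-ones vector, $\otimes$ the Kronecker product, $\|\cdot\|$ the Euclidean norm for vectors and the spectral norm for matrices. *)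

theory Defs
  imports "HOL-Analysis.Analysis"
begin

section \<open>Gradients\<close>

text \<open>Only meaningful where \<open>f\<close> is differentiable.\<close>

definition gradient :: "('a::real_inner \<Rightarrow> real) \<Rightarrow> 'a \<Rightarrow> 'a" where
  "gradient f u = (THE D. GDERIV f u :> D)"

lemma gderiv_unique:
  assumes "GDERIV f u :> D" "GDERIV f u :> E"
  shows "D = E"
proof -
  have "(\<lambda>h. h \<bullet> D) = (\<lambda>h. h \<bullet> E)"
    using assms unfolding gderiv_def by (rule has_derivative_unique)
  then have "(D - E) \<bullet> (D - E) = 0"
    by (metis inner_diff_right right_minus_eq)
  then show ?thesis by simp
qed

lemma gradient_eqI: "GDERIV f u :> D \<Longrightarrow> gradient f u = D"
  unfolding gradient_def by (blast intro: gderiv_unique the_equality)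

lemma differentiable_imp_gderiv_gradient:
  fixes f :: "'a::euclidean_space \<Rightarrow> real"
  assumes "f differentiable (at u)"
  shows "GDERIV f u :> gradient f u"
proof -
  obtain f' where f': "(f has_derivative f') (at u)"
    using assms by (auto simp: differentiable_def)
  then have lin: "linear f'" by (rule has_derivative_linear)
  have "f' = (\<lambda>h. h \<bullet> adjoint f' 1)"
    using adjoint_works[OF lin, of _ 1] by (auto simp: inner_real_def)
  with f' have "GDERIV f u :> adjoint f' 1"
    unfolding gderiv_def by simp
  then show ?thesis using gradient_eqI by metis
qed

section \<open>Kronecker products, diagonal and column-stochastic matrices\<close>

definition kron :: "real^'n^'m \<Rightarrow> real^'q^'p \<Rightarrow> real^('n \<times> 'q)^('m \<times> 'p)"
    (infixl "\<otimes>\<^sub>K" 75) where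
  "A \<otimes>\<^sub>K B = (\<chi> p q. A $ fst p $ fst q * B $ snd p $ snd q)"

definition diag_mat :: "real^'m \<Rightarrow> real^'m^'m" where
  "diag_mat v = (\<chi> i j. if i = j then v $ i else 0)"

definition column_stochastic :: "real^'m^'m \<Rightarrow> bool" where
  "column_stochastic B \<longleftrightarrow> (\<forall>i j. 0 \<le> B $ i $ j) \<and> (\<forall>j. (\<Sum>i\<in>UNIV. B $ i $ j) = 1)"

definition spectral_norm :: "real^'n^'m \<Rightarrow> real" where
  "spectral_norm A = onorm ((*v) A)"

text \<open>The matrix \<open>1 1\<^sup>T / m\<close>.\<close>

definition averaging_matrix :: "real^'m^'m" where
  "averaging_matrix = (\<chi> i j. 1 / real CARD('m))"

text \<open>Agents \<open>i\<close> and \<open>j\<close> are adjacent iff \<open>W $ i $ j > 0\<close>; the last conjunct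
  says that this graph is undirected. The weights themselves need not be symmetric.\<close>

definition interaction_weights :: "real^'m^'m \<Rightarrow> bool" where
  "interaction_weights W \<longleftrightarrow>
     (\<forall>i j. 0 \<le> W $ i $ j) \<and> (\<forall>i. 0 < W $ i $ i) \<and>
     (\<forall>i j. 0 < W $ i $ j \<longleftrightarrow> 0 < W $ j $ i)"

section \<open>Stacked vectors\<close>

text \<open>A vector of \<open>m\<close> blocks in \<open>\<real>\<^sup>d\<close> is indexed by pairs (agent, coordinate), which matches
  the index type of Kronecker products with \<open>d \<times> d\<close> matrices.\<close>

definition stack :: "('m::finite \<Rightarrow> real^'d) \<Rightarrow> real^('m \<times> 'd)" where
  "stack v = (\<chi> p. v (fst p) $ snd p)"

definition block :: "real^('m::finite \<times> 'd) \<Rightarrow> 'm \<Rightarrow> real^'d" where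
  "block x i = (\<chi> l. x $ (i, l))"

definition block_mean :: "real^('m::finite \<times> 'd) \<Rightarrow> real^'d" where
  "block_mean x = (1 / real CARD('m)) *\<^sub>R (\<Sum>i\<in>UNIV. block x i)"

lemma block_stack [simp]: "block (stack v) i = v i"
  by (simp add: block_def stack_def vec_eq_iff)

lemma stack_block [simp]: "stack (block x) = x"
  by (simp add: block_def stack_def vec_eq_iff)

lemma block_kron_mat_1:
  "block ((A \<otimes>\<^sub>K mat 1) *v x) i = (\<Sum>j\<in>UNIV. A $ i $ j *\<^sub>R block x j)"
proof -
  have "(\<Sum>q\<in>UNIV. A $ i $ fst q * (if l = snd q then 1 else 0) * x $ q)
      = (\<Sum>j\<in>UNIV. A $ i $ j * x $ (j, l))" for l
  proof -
    have "(\<Sum>q\<in>UNIV. A $ i $ fst q * (if l = snd q then 1 else 0) * x $ q)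
        = (\<Sum>j\<in>UNIV. \<Sum>l'\<in>UNIV. A $ i $ j * (if l = l' then 1 else 0) * x $ (j, l'))"
      by (simp add: sum.cartesian_product split_def UNIV_Times_UNIV [symmetric]
          del: UNIV_Times_UNIV)
    also have "\<dots> = (\<Sum>j\<in>UNIV. \<Sum>l'\<in>UNIV. if l = l' then A $ i $ j * x $ (j, l') else 0)"
      by (intro sum.cong) auto
    finally show ?thesis by simp
  qed
  then show ?thesis
    by (simp add: vec_eq_iff block_def kron_def matrix_vector_mult_def mat_def)
qed

section \<open>The algorithm\<close>

definition objective :: "('m::finite \<Rightarrow> real^'d \<Rightarrow> real) \<Rightarrow> real^'d \<Rightarrow> real" where
  "objective f \<theta> = (1 / real CARD('m)) * (\<Sum>i\<in>UNIV. f i \<theta>)"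

definition stacked_gradient ::
    "('m::finite \<Rightarrow> real^'d \<Rightarrow> real) \<Rightarrow> real^('m \<times> 'd) \<Rightarrow> real^('m \<times> 'd)" where
  "stacked_gradient f x = stack (\<lambda>i. gradient (f i) (block x i))"

definition PDG_NDS ::
    "real^'m^'m \<Rightarrow> (nat \<Rightarrow> real^'m^'m) \<Rightarrow> (nat \<Rightarrow> real^'m) \<Rightarrow> ('m \<Rightarrow> real^'d \<Rightarrow> real) \<Rightarrow>
     (nat \<Rightarrow> real^('m \<times> 'd)) \<Rightarrow> bool" where
  "PDG_NDS W B lam f x \<longleftrightarrow>
     x 1 = (W \<otimes>\<^sub>K mat 1) *v x 0 - (diag_mat (lam 0) \<otimes>\<^sub>K mat 1) *v stacked_gradient f (x 0) \<and>
     (\<forall>k. x (k + 2) =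
        2 *\<^sub>R ((W \<otimes>\<^sub>K mat 1) *v x (k + 1)) - ((W ** W) \<otimes>\<^sub>K mat 1) *v x k
        - (((B k ** diag_mat (lam (k + 1))) \<otimes>\<^sub>K mat 1) *v stacked_gradient f (x (k + 1))
           - ((B k ** diag_mat (lam k)) \<otimes>\<^sub>K mat 1) *v stacked_gradient f (x k)))"

definition auxiliary ::
    "real^'m^'m \<Rightarrow> (nat \<Rightarrow> real^('m \<times> 'd::finite)) \<Rightarrow> nat \<Rightarrow> real^('m \<times> 'd)" where
  "auxiliary W x k = (W \<otimes>\<^sub>K mat 1) *v x k - x (k + 1)"

definition mean_step :: "real^'m \<Rightarrow> real" where
  "mean_step v = (1 / real CARD('m)) * (\<Sum>i\<in>UNIV. v $ i)"

definition max_step :: "real^'m \<Rightarrow> real" where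
  "max_step v = Max (range (\<lambda>i. v $ i))"

end

theory Submission
  imports Defs
begin

text \<open>
  With \<open>y\<^sup>k = W x\<^sup>k - x\<^sup>k\<^sup>+\<^sup>1\<close> the method is the first-order system \<open>x\<^sup>k\<^sup>+\<^sup>1 = W x\<^sup>k - y\<^sup>k\<close>,
  \<open>y\<^sup>k\<^sup>+\<^sup>1 = W y\<^sup>k + B\<^sup>k (\<Lambda>\<^sup>k\<^sup>+\<^sup>1 g\<^sup>k\<^sup>+\<^sup>1 - \<Lambda>\<^sup>k g\<^sup>k)\<close>. The unit column sums of \<open>W\<close> and \<open>B\<^sup>k\<close> make \<open>y\<close> a
  tracker: the mean of \<open>y\<^sup>k\<close> is always the mean of the scaled gradients \<open>\<lambda>\<^sub>i\<^sup>k g\<^sub>i\<^sup>k\<close>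
  (\<open>block_mean_auxiliary\<close>). So the mean of \<open>x\<close> performs an inexact gradient step on \<open>F\<close>, with an
  error caused by the disagreement of the agents and by their unequal stepsizes (\<open>mean_descent\<close>), while
  the disagreements of \<open>x\<close> and \<open>y\<close> are contracted by \<open>W\<close> (\<open>disagreement_contraction\<close>) and driven by
  the change of the scaled gradients (\<open>tracked_change_bound\<close>, \<open>displacement_bound\<close>).

  A weighted sum \<open>V\<close> of the gap \<open>F - F(\<theta>\<^sup>*)\<close> at the mean and of the squared disagreements of \<open>x\<close> and
  \<open>y\<close> is a Lyapunov function (\<open>lyapunov_decrease\<close>): under the stepsize conditions it decreases up
  to terms in which squared gradient norms are multiplied by the squared stepsize variation or by the
  stepsize heterogeneity, both summable. By convexity, cocoercivity and the optimality of \<open>\<theta>\<^sup>*\<close> the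
  squared gradient norms are at most affine in \<open>V\<close> (\<open>gradients_bounded_by_gap\<close>), so a deterministic
  Robbins-Siegmund argument shows that \<open>V\<close> converges and that the decreases are summable. Hence the
  squared disagreements and the squared mean of \<open>y\<close> are summable and \<open>F\<close> converges along the mean.
  Writing \<open>l\<close> for the mean stepsize and \<open>ym\<close> for the mean of \<open>y\<close>, it also follows that
  \<open>l \<parallel>\<nabla>F\<parallel>\<^sup>2\<close> and \<open>\<parallel>ym\<parallel>\<^sup>2 / l\<close> are summable.

  These two sums give the full limit \<open>\<nabla>F \<rightarrow> 0\<close>, and not just a lower limit, without any
  study of excursions: as \<open>\<nabla>F\<close> is Lipschitz and the mean moves by \<open>ym\<close>, the increments of
  \<open>\<parallel>\<nabla>F\<parallel>\<^sup>2\<close> are at most \<open>l \<parallel>\<nabla>F\<parallel>\<^sup>2 + L\<^sup>2 \<parallel>ym\<parallel>\<^sup>2 / l + L\<^sup>2 \<parallel>ym\<parallel>\<^sup>2\<close>, hence summable. So \<open>\<parallel>\<nabla>F\<parallel>\<^sup>2\<close> converges, and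
  its limit is zero as the stepsizes have infinite sum. If the means stay bounded, convexity bounds the gap by
  a multiple of \<open>\<parallel>\<nabla>F\<parallel>\<close>, and the statements about optimality follow.
\<close>

section \<open>Smooth convex functions\<close>

lemma gderiv_along_line:
  fixes f :: "'a::real_inner \<Rightarrow> real"
  assumes "GDERIV f (u + t *\<^sub>R h) :> g"
  shows "((\<lambda>s. f (u + s *\<^sub>R h)) has_real_derivative g \<bullet> h) (at t)"
proof -
  have "((\<lambda>s. u + s *\<^sub>R h) has_derivative (\<lambda>s. s *\<^sub>R h)) (at t)"
    by (auto intro!: derivative_eq_intros)
  from has_derivative_compose[OF this assms[unfolded gderiv_def]]
  show ?thesis
    by (simp add: has_field_derivative_def inner_commute mult_commute_abs)
qed

text \<open>Along the segment from \<open>u\<close> to \<open>v\<close>, the difference \<open>\<phi>\<close> of \<open>f\<close> and its quadratic model has a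
  nonpositive derivative.\<close>

lemma smooth_upper_bound:
  fixes f :: "'a::euclidean_space \<Rightarrow> real"
  assumes diff: "\<And>u. f differentiable (at u)"
    and smooth: "\<And>u v. norm (gradient f u - gradient f v) \<le> L * norm (u - v)"
  shows "f v \<le> f u + gradient f u \<bullet> (v - u) + L / 2 * (norm (v - u))\<^sup>2"
proof -
  define h where "h = v - u"
  define \<phi> where "\<phi> t = f (u + t *\<^sub>R h) - t * (gradient f u \<bullet> h) - L / 2 * t\<^sup>2 * (norm h)\<^sup>2" for t
  have "\<exists>y. (\<phi> has_real_derivative y) (at t) \<and> y \<le> 0" if "0 \<le> t" "t \<le> 1" for t
  proof (intro exI conjI)
    show "(\<phi> has_real_derivative
        gradient f (u + t *\<^sub>R h) \<bullet> h - gradient f u \<bullet> h - L * t * (norm h)\<^sup>2) (at t)"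
      unfolding \<phi>_def
      by (auto intro!: derivative_eq_intros gderiv_along_line
          differentiable_imp_gderiv_gradient diff)
    have "gradient f (u + t *\<^sub>R h) \<bullet> h - gradient f u \<bullet> h
        = (gradient f (u + t *\<^sub>R h) - gradient f u) \<bullet> h"
      by (simp add: inner_diff_left)
    also have "\<dots> \<le> norm (gradient f (u + t *\<^sub>R h) - gradient f u) * norm h"
      by (rule norm_cauchy_schwarz)
    also have "\<dots> \<le> (L * norm (t *\<^sub>R h)) * norm h"
      using smooth[of "u + t *\<^sub>R h" u] by (intro mult_right_mono) auto
    finally show "gradient f (u + t *\<^sub>R h) \<bullet> h - gradient f u \<bullet> h - L * t * (norm h)\<^sup>2 \<le> 0"
      using that by (simp add: power2_eq_square mult.assoc)
  qed
  then have "\<phi> 1 \<le> \<phi> 0"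
    by (rule DERIV_nonpos_imp_nonincreasing[rotated]) simp_all
  then show ?thesis by (simp add: \<phi>_def h_def)
qed

lemma convex_above_tangent:
  fixes f :: "'a::euclidean_space \<Rightarrow> real"
  assumes conv: "convex_on UNIV f" and diff: "f differentiable (at u)"
  shows "f u + gradient f u \<bullet> (v - u) \<le> f v"
proof -
  define \<phi> where "\<phi> t = f (u + t *\<^sub>R (v - u))" for t
  have "convex_on UNIV \<phi>"
  proof (rule convex_onI)
    fix t x y :: real assume "0 < t" "t < 1"
    then show "\<phi> ((1 - t) *\<^sub>R x + t *\<^sub>R y) \<le> (1 - t) * \<phi> x + t * \<phi> y"
      using convex_onD[OF conv, of t "u + x *\<^sub>R (v - u)" "u + y *\<^sub>R (v - u)"]
      unfolding \<phi>_def by (simp add: algebra_simps)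
  qed simp
  moreover have "(\<phi> has_real_derivative gradient f u \<bullet> (v - u)) (at 0)"
    unfolding \<phi>_def
    by (rule gderiv_along_line)
      (simp add: differentiable_imp_gderiv_gradient diff)
  ultimately have "\<phi> 1 - \<phi> 0 \<ge> gradient f u \<bullet> (v - u) * (1 - 0)"
    by (intro convex_on_imp_above_tangent[where A = UNIV]) auto
  then show ?thesis by (simp add: \<phi>_def)
qed

text \<open>A gradient step from \<open>u\<close> on the function \<open>f - \<langle>\<nabla>f v, \<cdot>\<rangle>\<close>, which is minimal at \<open>v\<close>, cannot go below
  that minimum, but smoothness makes it decrease by the square of the gradient difference.
  Measuring the gap from the tangent at \<open>v\<close> is what gives a bound for the local objectives, whose
  infimum may be \<open>-\<infinity>\<close>.\<close>

lemma cocoercive: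
  fixes f :: "'a::euclidean_space \<Rightarrow> real"
  assumes conv: "convex_on UNIV f"
    and diff: "\<And>u. f differentiable (at u)" and L: "0 < L"
    and smooth: "\<And>u v. norm (gradient f u - gradient f v) \<le> L * norm (u - v)"
  shows "(norm (gradient f u - gradient f v))\<^sup>2
    \<le> 2 * L * (f u - f v - gradient f v \<bullet> (u - v))"
proof -
  define D where "D = gradient f u - gradient f v"
  \<comment> \<open>the gradient step from \<open>u\<close>\<close>
  define w where "w = u - (1 / L) *\<^sub>R D"
  have "f v + gradient f v \<bullet> (w - v) \<le> f w"
    by (rule convex_above_tangent[OF conv diff])
  also have "\<dots> \<le> f u + gradient f u \<bullet> (w - u) + L / 2 * (norm (w - u))\<^sup>2"
    by (rule smooth_upper_bound[OF diff smooth])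
  also have "\<dots> = f u - (1 / L) * (gradient f u \<bullet> D) + (norm D)\<^sup>2 / (2 * L)"
    using L by (simp add: w_def power2_eq_square field_simps)
  finally have "f v + gradient f v \<bullet> (u - v) - (1 / L) * (gradient f v \<bullet> D)
      \<le> f u - (1 / L) * (gradient f u \<bullet> D) + (norm D)\<^sup>2 / (2 * L)"
    by (simp add: w_def inner_diff_right)
  moreover have "gradient f u \<bullet> D - gradient f v \<bullet> D = (norm D)\<^sup>2"
    by (simp add: D_def power2_norm_eq_inner inner_diff_left)
  then have "(1 / L) * (gradient f u \<bullet> D) - (1 / L) * (gradient f v \<bullet> D) = (norm D)\<^sup>2 / L"
    by (metis right_diff_distrib mult_1 times_divide_eq_left)
  moreover have "(norm D)\<^sup>2 / L = 2 * ((norm D)\<^sup>2 / (2 * L))"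
    by simp
  ultimately have "(norm D)\<^sup>2 / (2 * L) \<le> f u - f v - gradient f v \<bullet> (u - v)"
    by linarith
  then show ?thesis
    using L by (simp add: D_def field_simps)
qed

section \<open>Perturbed monotone real sequences\<close>

text \<open>The factors \<open>1 + s k\<close> have a bounded product, because \<open>1 + s k \<le> exp (s k)\<close>; so \<open>V\<close> is bounded,
  and the multiplicative perturbation turns into the summable additive perturbation \<open>e\<close>. Then
  \<open>V\<close> minus the partial sums of \<open>e\<close> is decreasing.\<close>

lemma robbins_siegmund_deterministic:
  fixes V s t D :: "nat \<Rightarrow> real"
  assumes step: "\<And>k. V (Suc k) \<le> (1 + s k) * V k + t k - D k"
    and nonneg: "\<And>k. 0 \<le> V k" "\<And>k. 0 \<le> s k" "\<And>k. 0 \<le> t k" "\<And>k. 0 \<le> D k"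
    and s: "summable s" and t: "summable t"
  shows "summable D" "convergent V"
proof -
  have bound: "V k \<le> exp (\<Sum>j<k. s j) * (V 0 + (\<Sum>j<k. t j))" for k
  proof (induction k)
    case (Suc k)
    let ?M = "V 0 + (\<Sum>j<k. t j)"
    have M: "0 \<le> ?M" by (intro add_nonneg_nonneg sum_nonneg nonneg)
    have "V (Suc k) \<le> (1 + s k) * V k + t k"
      using step[of k] nonneg(4)[of k] by linarith
    also have "\<dots> \<le> exp (s k) * (exp (\<Sum>j<k. s j) * ?M) + exp (\<Sum>j<Suc k. s j) * t k"
    proof (rule add_mono)
      show "(1 + s k) * V k \<le> exp (s k) * (exp (\<Sum>j<k. s j) * ?M)"
        by (intro mult_mono exp_ge_add_one_self Suc.IH nonneg exp_ge_zero)
      have "1 \<le> exp (\<Sum>j<Suc k. s j)"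
        using sum_nonneg[of "{..<Suc k}" s] nonneg(2) by simp
      then show "t k \<le> exp (\<Sum>j<Suc k. s j) * t k"
        using mult_right_mono[of 1 "exp (\<Sum>j<Suc k. s j)" "t k"] nonneg(3)[of k] by simp
    qed
    also have "\<dots> = exp (\<Sum>j<Suc k. s j) * (V 0 + (\<Sum>j<Suc k. t j))"
      by (simp add: exp_add algebra_simps)
    finally show ?case .
  qed simp
  define M where "M = exp (suminf s) * (V 0 + suminf t)"
  have VM: "V k \<le> M" for k
  proof -
    have "exp (\<Sum>j<k. s j) * (V 0 + (\<Sum>j<k. t j)) \<le> M"
      unfolding M_def
    proof (rule mult_mono)
      show "exp (\<Sum>j<k. s j) \<le> exp (suminf s)"
        using sum_le_suminf[OF s, of "{..<k}"] nonneg(2) by simp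
      show "V 0 + (\<Sum>j<k. t j) \<le> V 0 + suminf t"
        using sum_le_suminf[OF t, of "{..<k}"] nonneg(3) by simp
      show "0 \<le> V 0 + (\<Sum>j<k. t j)"
        by (intro add_nonneg_nonneg sum_nonneg nonneg)
    qed simp
    with bound[of k] show ?thesis by linarith
  qed
  define e where "e k = s k * M + t k" for k
  have e: "summable e" unfolding e_def by (intro summable_add summable_mult2 s t)
  have M0: "0 \<le> M" using VM[of 0] nonneg(1)[of 0] by linarith
  have e0: "0 \<le> e k" for k
    unfolding e_def using M0 nonneg by simp
  have step': "V (Suc k) \<le> V k + e k - D k" for k
    using step[of k] mult_left_mono[OF VM[of k] nonneg(2)[of k]]
    by (simp add: e_def algebra_simps)
  have tel: "V k + (\<Sum>j<k. D j) \<le> V 0 + (\<Sum>j<k. e j)" for k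
  proof (induction k)
    case (Suc k)
    then show ?case using step'[of k] by simp
  qed simp
  show "summable D"
  proof (rule bounded_imp_summable)
    show "(\<Sum>j\<le>k. D j) \<le> V 0 + suminf e" for k
      using tel[of "Suc k"] nonneg(1)[of "Suc k"] sum_le_suminf[OF e, of "{..k}"] e0
      by (simp add: lessThan_Suc_atMost)
  qed (use nonneg in auto)
  define U where "U k = V k - (\<Sum>j<k. e j)" for k
  have "decseq U"
  proof (rule decseq_SucI)
    show "U (Suc k) \<le> U k" for k
      using step'[of k] nonneg(4)[of k] by (simp add: U_def)
  qed
  moreover have "- suminf e \<le> U k" for k
    using sum_le_suminf[OF e, of "{..<k}"] e0 nonneg(1)[of k] by (simp add: U_def)
  ultimately obtain z where "U \<longlonglongrightarrow> z"
    using decseq_convergent by metis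
  then have "(\<lambda>k. U k + (\<Sum>j<k. e j)) \<longlonglongrightarrow> z + suminf e"
    using summable_LIMSEQ[OF e] by (intro tendsto_add)
  then show "convergent V"
    by (auto simp: U_def convergent_def)
qed

lemma summable_increments_convergent:
  fixes a :: "nat \<Rightarrow> real"
  assumes d: "summable d" and inc: "\<And>k. \<bar>a (Suc k) - a k\<bar> \<le> d k"
  shows "convergent a"
proof -
  have "summable (\<lambda>k. a (Suc k) - a k)"
    by (rule summable_comparison_test'[OF d, of 0]) (use inc in auto)
  then have "(\<lambda>n. a 0 + (\<Sum>k<n. a (Suc k) - a k)) \<longlonglongrightarrow> a 0 + (\<Sum>k. a (Suc k) - a k)"
    by (intro tendsto_add tendsto_const summable_LIMSEQ)
  then show ?thesis
    by (auto simp: sum_lessThan_telescope convergent_def)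
qed

text \<open>If \<open>a\<close> had a positive limit, \<open>l\<close> would eventually be dominated by a multiple of \<open>l k * a k\<close>.\<close>

lemma weighted_summable_limit_zero:
  fixes a l :: "nat \<Rightarrow> real"
  assumes a: "convergent a" and nonneg: "\<And>k. 0 \<le> a k" "\<And>k. 0 \<le> l k"
    and la: "summable (\<lambda>k. l k * a k)" and l: "\<not> summable l"
  shows "a \<longlonglongrightarrow> 0"
proof -
  obtain z where z: "a \<longlonglongrightarrow> z" using a by (auto simp: convergent_def)
  have "z \<ge> 0" using z nonneg by (intro LIMSEQ_le_const) auto
  moreover have "\<not> z > 0"
  proof
    assume pos: "z > 0"
    then have "eventually (\<lambda>k. z / 2 < a k) sequentially"
      using z by (intro order_tendstoD(1)) auto
    then obtain N where N: "\<And>k. k \<ge> N \<Longrightarrow> z / 2 < a k"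
      by (auto simp: eventually_sequentially)
    have "summable l"
    proof (rule summable_comparison_test'[OF summable_mult[OF la, of "2 / z"], of N])
      fix k assume "k \<ge> N"
      then have "z / 2 * l k \<le> a k * l k"
        using N[of k] nonneg by (intro mult_right_mono) auto
      then show "norm (l k) \<le> 2 / z * (l k * a k)"
        using pos nonneg by (simp add: field_simps)
    qed
    with l show False by simp
  qed
  ultimately show ?thesis using z by (simp add: order_less_le)
qed

section \<open>Stacked vectors and disagreement\<close>

text \<open>\<open>A \<otimes> I\<close> as an operator: every agent replaces its block by a linear combination of the blocks of
  the agents, with the weights in its row of \<open>A\<close>.\<close>

abbreviation mix :: "real^'m^'m \<Rightarrow> real^('m::finite \<times> 'd::finite) \<Rightarrow> real^('m \<times> 'd)" where
  "mix A x \<equiv> (A \<otimes>\<^sub>K mat 1) *v x"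

definition consensus :: "real^'d \<Rightarrow> real^('m::finite \<times> 'd)" where
  "consensus v = stack (\<lambda>_. v)"

text \<open>The orthogonal projection onto the complement of the consensus subspace; its norm is the
  consensus error.\<close>

definition disagreement :: "real^('m::finite \<times> 'd::finite) \<Rightarrow> real^('m \<times> 'd)" where
  "disagreement x = x - consensus (block_mean x)"

lemma block_add [simp]: "block (x + y) i = block x i + block y i"
  and block_diff [simp]: "block (x - y) i = block x i - block y i"
  and block_minus [simp]: "block (- x) i = - block x i"
  and block_scaleR [simp]: "block (a *\<^sub>R x) i = a *\<^sub>R block x i"
  by (simp_all add: block_def vec_eq_iff)

lemma block_consensus [simp]: "block (consensus v) i = v"
  by (simp add: consensus_def)

lemma block_eqI: "(\<And>i. block x i = block y i) \<Longrightarrow> x = y"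
  by (metis ext stack_block)

lemma block_mean_add: "block_mean (x + y) = block_mean x + block_mean y"
  and block_mean_diff: "block_mean (x - y) = block_mean x - block_mean y"
  and block_mean_minus: "block_mean (- x) = - block_mean x"
  and block_mean_scaleR: "block_mean (a *\<^sub>R x) = a *\<^sub>R block_mean x"
  by (simp_all add: block_mean_def sum.distrib sum_subtractf sum_negf scaleR_right_distrib
      scaleR_right_diff_distrib scaleR_right.sum mult.commute)

lemma block_mean_consensus [simp]:
  "block_mean (consensus v :: real^('m::finite \<times> 'd::finite)) = v"
  by (simp add: block_mean_def sum_constant_scaleR del: sum_constant)

lemma disagreement_add: "disagreement (x + y) = disagreement x + disagreement y"
  and disagreement_minus: "disagreement (- x) = - disagreement x"
  by (auto intro!: block_eqI simp: disagreement_def block_mean_add block_mean_minus)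

lemma block_disagreement [simp]: "block (disagreement x) i = block x i - block_mean x"
  by (simp add: disagreement_def)

lemma sum_block: "(\<Sum>i\<in>UNIV. block x i) = real CARD('m) *\<^sub>R block_mean x"
  for x :: "real^('m::finite \<times> 'd::finite)"
  by (simp add: block_mean_def)

lemma norm_eq_sum_blocks: "(norm x)\<^sup>2 = (\<Sum>i\<in>UNIV. (norm (block x i))\<^sup>2)"
  for x :: "real^('m::finite \<times> 'd::finite)"
proof -
  have "(norm x)\<^sup>2 = (\<Sum>p\<in>UNIV. (x $ p)\<^sup>2)"
    by (simp add: norm_vec_def L2_set_def sum_nonneg)
  also have "\<dots> = (\<Sum>i\<in>UNIV. \<Sum>l\<in>UNIV. (x $ (i, l))\<^sup>2)"
    by (simp add: sum.cartesian_product split_def UNIV_Times_UNIV [symmetric]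
          del: UNIV_Times_UNIV)
  finally show ?thesis
    by (simp add: norm_vec_def L2_set_def sum_nonneg block_def)
qed

lemma norm_block_le: "norm (block x i) \<le> norm x"
  for x :: "real^('m::finite \<times> 'd::finite)"
proof (rule power2_le_imp_le)
  show "(norm (block x i))\<^sup>2 \<le> (norm x)\<^sup>2"
    unfolding norm_eq_sum_blocks by (rule member_le_sum) auto
qed simp

text \<open>Pythagoras for the consensus subspace. It is what makes the disagreement and the mean separate
  quantities in the estimate of \<open>x\<^sup>k\<^sup>+\<^sup>1 - x\<^sup>k\<close>.\<close>

lemma norm_square_split:
  "(norm x)\<^sup>2 = (norm (disagreement x))\<^sup>2 + real CARD('m) * (norm (block_mean x))\<^sup>2"
  for x :: "real^('m::finite \<times> 'd::finite)"
proof -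
  let ?b = "block_mean x"
  have "(norm (disagreement x))\<^sup>2
      = (\<Sum>i\<in>UNIV. (norm (block x i))\<^sup>2 - 2 * (block x i \<bullet> ?b) + (norm ?b)\<^sup>2)"
    unfolding norm_eq_sum_blocks
    by (intro sum.cong) (simp_all add: power2_norm_eq_inner inner_diff_left inner_diff_right
        inner_commute)
  also have "\<dots> = (norm x)\<^sup>2 - 2 * ((\<Sum>i\<in>UNIV. block x i) \<bullet> ?b) + real CARD('m) * (norm ?b)\<^sup>2"
    by (simp add: sum.distrib sum_subtractf norm_eq_sum_blocks inner_sum_left sum_distrib_left)
  also have "\<dots> = (norm x)\<^sup>2 - real CARD('m) * (norm ?b)\<^sup>2"
    by (simp add: sum_block power2_norm_eq_inner)
  finally show ?thesis by simp
qed

lemma norm_disagreement_le: "(norm (disagreement x))\<^sup>2 \<le> (norm x)\<^sup>2"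
  for x :: "real^('m::finite \<times> 'd::finite)"
  using norm_square_split[of x] by simp

lemma norm_block_mean_le: "(norm (block_mean x))\<^sup>2 \<le> (norm x)\<^sup>2 / real CARD('m)"
  for x :: "real^('m::finite \<times> 'd::finite)"
  using norm_square_split[of x] by (simp add: field_simps)

section \<open>Mixing by matrices over the agents\<close>

lemma norm_matrix_vector_le_spectral_norm: "norm (A *v v) \<le> spectral_norm A * norm v"
  unfolding spectral_norm_def by (rule onorm) (simp add: matrix_vector_mul_bounded_linear)

lemma spectral_norm_nonneg: "0 \<le> spectral_norm A"
  unfolding spectral_norm_def by (rule onorm_pos_le) (simp add: matrix_vector_mul_bounded_linear)

text \<open>\<open>A \<otimes> I\<close> acts as \<open>A\<close> on each of the \<open>d\<close> coordinate slices separately.\<close>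

lemma norm_mix_le: "norm (mix A x) \<le> spectral_norm A * norm x"
  for x :: "real^('m::finite \<times> 'd::finite)"
proof (rule power2_le_imp_le)
  define u where "u l = (\<chi> j. x $ (j, l))" for l :: 'd
  have split: "(norm z)\<^sup>2 = (\<Sum>l\<in>UNIV. \<Sum>i\<in>UNIV. (z $ (i, l))\<^sup>2)" for z :: "real^('m \<times> 'd)"
    unfolding norm_eq_sum_blocks
    by (subst sum.swap) (simp add: norm_vec_def L2_set_def sum_nonneg block_def)
  have "(A *v u l) $ i = mix A x $ (i, l)" for i l
    using arg_cong[OF block_kron_mat_1[of A x i], of "\<lambda>v. v $ l"]
    by (simp add: u_def block_def matrix_vector_mult_def)
  then have "(norm (mix A x))\<^sup>2 = (\<Sum>l\<in>UNIV. (norm (A *v u l))\<^sup>2)"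
    unfolding split[of "mix A x"] by (simp add: norm_vec_def L2_set_def sum_nonneg)
  also have "\<dots> \<le> (\<Sum>l\<in>UNIV. (spectral_norm A * norm (u l))\<^sup>2)"
    by (intro sum_mono power_mono norm_matrix_vector_le_spectral_norm) simp
  also have "\<dots> = (spectral_norm A * norm x)\<^sup>2"
    by (simp add: power_mult_distrib sum_distrib_left[symmetric] split u_def)
      (simp add: norm_vec_def L2_set_def sum_nonneg)
  finally show "(norm (mix A x))\<^sup>2 \<le> (spectral_norm A * norm x)\<^sup>2" .
qed (simp add: spectral_norm_nonneg)

lemma mix_matrix_mult: "mix (A ** B) x = mix A (mix B x)"
  for x :: "real^('m::finite \<times> 'd::finite)"
proof (rule block_eqI)
  fix i
  have "block (mix (A ** B) x) i = (\<Sum>k\<in>UNIV. \<Sum>j\<in>UNIV. (A $ i $ j * B $ j $ k) *\<^sub>R block x k)"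
    by (simp add: block_kron_mat_1 matrix_matrix_mult_def scaleR_sum_left)
  also have "\<dots> = block (mix A (mix B x)) i"
    by (subst sum.swap) (simp add: block_kron_mat_1 scaleR_sum_right)
  finally show "block (mix (A ** B) x) i = block (mix A (mix B x)) i" .
qed

lemma block_mix_diag: "block (mix (diag_mat v) x) i = v $ i *\<^sub>R block x i"
proof -
  have "block (mix (diag_mat v) x) i = (\<Sum>j\<in>UNIV. if i = j then v $ i *\<^sub>R block x j else 0)"
    unfolding block_kron_mat_1 by (intro sum.cong) (auto simp: diag_mat_def)
  then show ?thesis by simp
qed

lemma mix_mat_1: "mix (mat 1) x = x"
proof (rule block_eqI)
  fix i
  have "block (mix (mat 1) x) i = (\<Sum>j\<in>UNIV. if i = j then block x j else 0)"
    unfolding block_kron_mat_1 by (intro sum.cong) (auto simp: mat_def)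
  then show "block (mix (mat 1) x) i = block x i" by simp
qed

lemma mix_diff_left: "mix (A - A') x = mix A x - mix A' x"
  by (rule block_eqI) (simp add: block_kron_mat_1 scaleR_left_diff_distrib sum_subtractf)

lemma mix_consensus:
  assumes "A *v 1 = 1"
  shows "mix A (consensus v) = consensus v"
proof (rule block_eqI)
  fix i
  have "(\<Sum>j\<in>UNIV. A $ i $ j) = 1"
    using arg_cong[OF assms, of "\<lambda>v. v $ i"] by (simp add: matrix_vector_mult_def)
  then show "block (mix A (consensus v)) i = block (consensus v) i"
    by (simp add: block_kron_mat_1 scaleR_sum_left[symmetric])
qed

lemma block_mean_mix:
  fixes x :: "real^('m::finite \<times> 'd::finite)"
  assumes "1 v* A = 1"
  shows "block_mean (mix A x) = block_mean x"
proof -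
  have col: "(\<Sum>i\<in>UNIV. A $ i $ j) = 1" for j
    using arg_cong[OF assms, of "\<lambda>v. v $ j"] by (simp add: vector_matrix_mult_def)
  have "(\<Sum>i\<in>UNIV. \<Sum>j\<in>UNIV. A $ i $ j *\<^sub>R block x j)
      = (\<Sum>j\<in>UNIV. (\<Sum>i\<in>UNIV. A $ i $ j) *\<^sub>R block x j)"
    by (subst sum.swap) (simp add: scaleR_sum_left)
  then show ?thesis
    by (simp add: block_mean_def block_kron_mat_1 col)
qed

lemma column_stochastic_left_eigenvector: "column_stochastic A \<Longrightarrow> 1 v* A = 1"
  by (simp add: column_stochastic_def vec_eq_iff vector_matrix_mult_def)

lemma mix_averaging: "mix averaging_matrix x = consensus (block_mean x)"
  by (rule block_eqI)
    (simp add: block_kron_mat_1 averaging_matrix_def block_mean_def scaleR_right.sum)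

text \<open>\<open>W\<close> fixes the consensus subspace and preserves the mean, and the averaging matrix annihilates
  vectors of mean zero.\<close>

lemma disagreement_mix:
  assumes "1 v* W = 1" "W *v 1 = 1"
  shows "disagreement (mix W x) = mix (W - averaging_matrix) (disagreement x)"
proof -
  have "block_mean (disagreement x) = 0"
    by (simp add: disagreement_def block_mean_diff)
  then have "mix averaging_matrix (disagreement x) = 0"
    by (simp add: mix_averaging consensus_def stack_def vec_eq_iff)
  moreover have "mix W (disagreement x) = mix W x - consensus (block_mean x)"
    by (simp add: disagreement_def matrix_vector_mult_diff_distrib mix_consensus assms)
  ultimately show ?thesis
    by (simp add: mix_diff_left disagreement_def[of "mix W x"] block_mean_mix assms)
qed

text \<open>Convexity of the square, since \<open>\<eta> a + b = \<eta> a + (1 - \<eta>) (b / (1 - \<eta>))\<close>. In contrast to the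
  usual \<open>2 a\<^sup>2 + 2 b\<^sup>2\<close> it keeps the contraction factor \<open>\<eta>\<close> below one.\<close>

lemma convex_square:
  fixes a b \<eta> :: real
  assumes "0 \<le> \<eta>" "\<eta> < 1"
  shows "(\<eta> * a + b)\<^sup>2 \<le> \<eta> * a\<^sup>2 + b\<^sup>2 / (1 - \<eta>)"
proof -
  have "0 \<le> \<eta> * ((1 - \<eta>) * a - b)\<^sup>2 / (1 - \<eta>)"
    using assms by simp
  also have "\<eta> * ((1 - \<eta>) * a - b)\<^sup>2 / (1 - \<eta>) = \<eta> * a\<^sup>2 + b\<^sup>2 / (1 - \<eta>) - (\<eta> * a + b)\<^sup>2"
    using assms by (simp add: field_simps power2_eq_square)
  finally show ?thesis by simp
qed

lemma disagreement_contraction: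
  assumes W: "1 v* W = 1" "W *v 1 = 1"
    and \<eta>: "\<eta> = spectral_norm (W - averaging_matrix)" "\<eta> < 1"
  shows "(norm (disagreement (mix W x + v)))\<^sup>2
    \<le> \<eta> * (norm (disagreement x))\<^sup>2 + (norm (disagreement v))\<^sup>2 / (1 - \<eta>)"
proof -
  have "norm (disagreement (mix W x + v)) \<le> norm (disagreement (mix W x)) + norm (disagreement v)"
    unfolding disagreement_add by (rule norm_triangle_ineq)
  also have "\<dots> \<le> \<eta> * norm (disagreement x) + norm (disagreement v)"
    using norm_mix_le[of "W - averaging_matrix" "disagreement x"] \<eta>
    by (simp add: disagreement_mix W)
  finally have "(norm (disagreement (mix W x + v)))\<^sup>2
      \<le> (\<eta> * norm (disagreement x) + norm (disagreement v))\<^sup>2"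
    by (intro power_mono) auto
  also have "\<dots> \<le> \<eta> * (norm (disagreement x))\<^sup>2 + (norm (disagreement v))\<^sup>2 / (1 - \<eta>)"
    using \<eta> spectral_norm_nonneg by (intro convex_square) auto
  finally show ?thesis .
qed

lemma norm_mix_diag_le:
  assumes "\<And>i. \<bar>v $ i\<bar> \<le> M"
  shows "(norm (mix (diag_mat v) x))\<^sup>2 \<le> M\<^sup>2 * (norm x)\<^sup>2"
proof -
  have "(v $ i)\<^sup>2 \<le> M\<^sup>2" for i
    using assms[of i] by (metis abs_ge_zero power2_abs power_mono)
  then show ?thesis
    unfolding norm_eq_sum_blocks sum_distrib_left block_mix_diag
    by (auto intro!: sum_mono mult_right_mono simp: power_mult_distrib)
qed

text \<open>A column-stochastic matrix is nonexpansive for the \<open>1\<close>-norm of the block norms, but not for the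
  Euclidean norm; comparing the two norms costs the factor \<open>m\<close>.\<close>

lemma norm_mix_column_stochastic_le:
  fixes x :: "real^('m::finite \<times> 'd::finite)"
  assumes "column_stochastic A"
  shows "(norm (mix A x))\<^sup>2 \<le> real CARD('m) * (norm x)\<^sup>2"
proof -
  have A: "0 \<le> A $ i $ j" "(\<Sum>i\<in>UNIV. A $ i $ j) = 1" for i j
    using assms by (auto simp: column_stochastic_def)
  have "(\<Sum>i\<in>UNIV. norm (block (mix A x) i))
      \<le> (\<Sum>i\<in>UNIV. \<Sum>j\<in>UNIV. A $ i $ j * norm (block x j))"
    unfolding block_kron_mat_1
    by (intro sum_mono order_trans[OF norm_sum]) (simp add: A)
  also have "\<dots> = (\<Sum>j\<in>UNIV. norm (block x j))"
    by (subst sum.swap) (simp add: sum_distrib_right[symmetric] A)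
  finally have l1: "(\<Sum>i\<in>UNIV. norm (block (mix A x) i)) \<le> (\<Sum>j\<in>UNIV. norm (block x j))" .
  have "norm (mix A x) = L2_set (\<lambda>i. norm (block (mix A x) i)) UNIV"
    unfolding L2_set_def norm_eq_sum_blocks[symmetric] by simp
  also have "\<dots> \<le> (\<Sum>i\<in>UNIV. norm (block (mix A x) i))"
    by (rule L2_set_le_sum) simp
  finally have "(norm (mix A x))\<^sup>2 \<le> (\<Sum>i\<in>UNIV. norm (block (mix A x) i))\<^sup>2"
    by (rule power_mono) simp
  also have "\<dots> \<le> (\<Sum>j\<in>UNIV. norm (block x j))\<^sup>2"
    by (intro power_mono l1 sum_nonneg) auto
  also have "\<dots> \<le> (norm x)\<^sup>2 * real CARD('m)"
    unfolding norm_eq_sum_blocks by (rule sum_squared_le_sum_of_squares)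
  finally show ?thesis by (simp add: mult.commute)
qed

section \<open>The average objective\<close>

lemma gderiv_objective:
  assumes "\<And>i. f i differentiable (at u)"
  shows "GDERIV (objective f) u :> block_mean (stacked_gradient f (consensus u))"
proof -
  have "((\<lambda>u. 1 / real CARD('m) * (\<Sum>i\<in>UNIV. f i u)) has_derivative
      (\<lambda>h. 1 / real CARD('m) * (\<Sum>i\<in>UNIV. h \<bullet> gradient (f i) u))) (at u)"
    using differentiable_imp_gderiv_gradient[OF assms]
    unfolding gderiv_def by (intro has_derivative_mult_right has_derivative_sum) auto
  then show ?thesis
    unfolding gderiv_def objective_def[abs_def]
    by (simp add: block_mean_def stacked_gradient_def inner_sum_right)
qed

lemma objective_differentiable:
  "(\<And>i. f i differentiable (at u)) \<Longrightarrow> objective f differentiable (at u)"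
  using gderiv_objective unfolding gderiv_def differentiable_def by blast

lemma gradient_objective:
  "(\<And>i. f i differentiable (at u)) \<Longrightarrow>
    gradient (objective f) u = block_mean (stacked_gradient f (consensus u))"
  by (rule gradient_eqI[OF gderiv_objective])

lemma convex_on_objective:
  "(\<And>i. convex_on UNIV (f i)) \<Longrightarrow> convex_on UNIV (objective f)"
proof -
  assume conv: "\<And>i. convex_on UNIV (f i)"
  have "convex_on UNIV (\<lambda>u. \<Sum>i\<in>I. f i u)" if "finite I" for I
    using that by (induction I) (auto intro!: convex_on_add conv simp: convex_on_const)
  then show ?thesis
    unfolding objective_def[abs_def] by (intro convex_on_cmul) auto
qed

lemma norm_stacked_gradient_diff_le:
  fixes f :: "'m::finite \<Rightarrow> real^'d \<Rightarrow> real"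
  assumes "\<And>i u v. norm (gradient (f i) u - gradient (f i) v) \<le> L * norm (u - v)"
  shows "(norm (stacked_gradient f x - stacked_gradient f z))\<^sup>2 \<le> L\<^sup>2 * (norm (x - z))\<^sup>2"
  unfolding norm_eq_sum_blocks sum_distrib_left power_mult_distrib[symmetric]
  by (intro sum_mono power_mono) (auto simp: stacked_gradient_def assms)

lemma gradient_objective_lipschitz:
  fixes f :: "'m::finite \<Rightarrow> real^'d \<Rightarrow> real"
  assumes diff: "\<And>i u. f i differentiable (at u)"
    and smooth: "\<And>i u v. norm (gradient (f i) u - gradient (f i) v) \<le> L * norm (u - v)"
  shows "norm (gradient (objective f) u - gradient (objective f) v) \<le> L * norm (u - v)"
proof -
  have "norm (gradient (objective f) u - gradient (objective f) v)
      = 1 / real CARD('m) * norm (\<Sum>i\<in>UNIV. gradient (f i) u - gradient (f i) v)"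
    by (simp add: gradient_objective diff block_mean_diff[symmetric])
      (simp add: block_mean_def stacked_gradient_def)
  also have "\<dots> \<le> 1 / real CARD('m) * (\<Sum>i::'m\<in>UNIV. L * norm (u - v))"
    by (intro mult_left_mono sum_norm_le smooth) auto
  finally show ?thesis by simp
qed

text \<open>A gradient step from \<open>p\<close> would otherwise decrease \<open>f\<close>.\<close>

lemma smooth_gradient_at_minimum:
  fixes f :: "'a::euclidean_space \<Rightarrow> real"
  assumes diff: "\<And>u. f differentiable (at u)" and L: "0 < L"
    and smooth: "\<And>u v. norm (gradient f u - gradient f v) \<le> L * norm (u - v)"
    and min: "\<And>u. f p \<le> f u"
  shows "gradient f p = 0"
proof -
  define D where "D = gradient f p"
  have "f p \<le> f (p - (1 / L) *\<^sub>R D)" by (rule min)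
  also have "\<dots> \<le> f p - (norm D)\<^sup>2 / L + L / 2 * (norm ((1 / L) *\<^sub>R D))\<^sup>2"
    using smooth_upper_bound[OF diff smooth, of "p - (1 / L) *\<^sub>R D" p]
    by (simp add: D_def power2_norm_eq_inner)
  also have "L / 2 * (norm ((1 / L) *\<^sub>R D))\<^sup>2 = (norm D)\<^sup>2 / (2 * L)"
    using L by (simp add: power2_eq_square)
  finally have "(norm D)\<^sup>2 \<le> 0"
    using L by (simp add: field_simps)
  then show ?thesis by (simp add: D_def)
qed

lemma power2_norm_add_le: "(norm (x + y))\<^sup>2 \<le> 2 * (norm x)\<^sup>2 + 2 * (norm y)\<^sup>2"
  for x y :: "'a::real_normed_vector"
proof -
  have "(norm (x + y))\<^sup>2 \<le> (norm x + norm y)\<^sup>2"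
    by (intro power_mono norm_triangle_ineq) simp
  also have "\<dots> \<le> 2 * (norm x)\<^sup>2 + 2 * (norm y)\<^sup>2"
    using sum_squares_bound[of "norm x" "norm y"] by (simp add: power2_sum)
  finally show ?thesis .
qed

text \<open>The single gradients need not be bounded, and the single \<open>f i\<close> need not be bounded below. But the
  gradients at the minimiser \<open>p\<close> of the average sum to zero, so that the linear terms in the
  cocoercivity inequalities cancel in the sum and only the gap of the average objective remains.
  This bound lets the Lyapunov function absorb the terms caused by changing and by unequal
  stepsizes.\<close>

lemma gradients_bounded_by_gap:
  fixes f :: "'m::finite \<Rightarrow> real^'d \<Rightarrow> real"
  assumes conv: "\<And>i. convex_on UNIV (f i)"
    and diff: "\<And>i u. f i differentiable (at u)" and L: "0 < L"
    and smooth: "\<And>i u v. norm (gradient (f i) u - gradient (f i) v) \<le> L * norm (u - v)"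
    and min: "\<And>u. objective f p \<le> objective f u"
  shows "(norm (stacked_gradient f (consensus u)))\<^sup>2
    \<le> 4 * L * real CARD('m) * (objective f u - objective f p)
      + 2 * (norm (stacked_gradient f (consensus p)))\<^sup>2"
proof -
  let ?g = "\<lambda>z. stacked_gradient f (consensus z)"
  have "gradient (objective f) p = 0"
  proof (rule smooth_gradient_at_minimum[where L = L])
    show "objective f p \<le> objective f u" for u by (rule min)
  qed (auto intro: objective_differentiable diff gradient_objective_lipschitz smooth L)
  then have stat: "(\<Sum>i\<in>UNIV. gradient (f i) p) = 0"
    by (simp add: gradient_objective diff block_mean_def stacked_gradient_def)
  have "(norm (?g u - ?g p))\<^sup>2 = (\<Sum>i\<in>UNIV. (norm (gradient (f i) u - gradient (f i) p))\<^sup>2)"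
    by (simp add: norm_eq_sum_blocks stacked_gradient_def)
  also have "\<dots> \<le> (\<Sum>i\<in>UNIV. 2 * L * (f i u - f i p - gradient (f i) p \<bullet> (u - p)))"
    by (intro sum_mono cocoercive conv diff L smooth)
  also have "\<dots> = 2 * L * ((\<Sum>i\<in>UNIV. f i u) - (\<Sum>i\<in>UNIV. f i p)
      - (\<Sum>i\<in>UNIV. gradient (f i) p) \<bullet> (u - p))"
    by (simp only: sum_distrib_left[symmetric] sum_subtractf inner_sum_left)
  also have "\<dots> = 2 * L * real CARD('m) * (objective f u - objective f p)"
    by (simp add: stat objective_def field_simps)
  finally show ?thesis
    using power2_norm_add_le[of "?g u - ?g p" "?g p"] by simp
qed

lemma norm_stacked_gradient_le:
  fixes f :: "'m::finite \<Rightarrow> real^'d \<Rightarrow> real"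
  assumes "\<And>i u v. norm (gradient (f i) u - gradient (f i) v) \<le> L * norm (u - v)"
  shows "(norm (stacked_gradient f x))\<^sup>2
    \<le> 2 * L\<^sup>2 * (norm (disagreement x))\<^sup>2
      + 2 * (norm (stacked_gradient f (consensus (block_mean x))))\<^sup>2"
  using power2_norm_add_le[of "stacked_gradient f x - stacked_gradient f (consensus (block_mean x))"
      "stacked_gradient f (consensus (block_mean x))"]
    norm_stacked_gradient_diff_le[where f = f, OF assms, of x "consensus (block_mean x)",
      folded disagreement_def]
  by simp

section \<open>One step of the method\<close>

lemma le_max_step: "v $ i \<le> max_step v"
  by (simp add: max_step_def)

lemma mean_step_zero:
  assumes "\<And>i. 0 \<le> v $ i" "mean_step v = 0"
  shows "v = 0"
  using assms by (simp add: mean_step_def sum_nonneg_eq_0_iff vec_eq_iff)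

text \<open>The mean moves by \<open>ym\<close>, which is \<open>l \<nabla>F(xm)\<close> with \<open>l\<close> the mean stepsize, up to the means of two errors: \<open>P\<close>,
  from evaluating the gradients at the \<open>x\<^sub>i\<close> and not at \<open>xm\<close>, and \<open>Q\<close>, from unequal stepsizes. In the
  descent inequality the product \<open>\<langle>\<nabla>F(xm), ym\<rangle>\<close> is replaced, by polarisation, by the squares of
  its factors and of the error \<open>ym - l \<nabla>F(xm)\<close>, and the bound on the maximal stepsize makes the
  contribution of \<open>P\<close> a fixed multiple of the squared disagreement. The case \<open>l = 0\<close> is separate: then all
  stepsizes vanish, and the quotients by \<open>l\<close> are zero by convention.\<close>

lemma mean_descent:
  fixes f :: "'m::finite \<Rightarrow> real^'d \<Rightarrow> real" and x :: "real^('m \<times> 'd)" and v :: "real^'m"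
  assumes diff: "\<And>i u. f i differentiable (at u)" and L: "0 < L"
    and smooth: "\<And>i u v. norm (gradient (f i) u - gradient (f i) v) \<le> L * norm (u - v)"
    and v: "\<And>i. 0 \<le> v $ i"
    and max: "2 * L / (real CARD('m) * mean_step v) * (max_step v)\<^sup>2 \<le> \<kappa>"
  defines "xm \<equiv> block_mean x"
    and "ym \<equiv> block_mean (mix (diag_mat v) (stacked_gradient f x))"
  shows "objective f (xm - ym) \<le> objective f xm
      - mean_step v / 2 * (norm (gradient (objective f) xm))\<^sup>2
      - (1 / (2 * mean_step v) - L / 2) * (norm ym)\<^sup>2
      + L * \<kappa> / 2 * (norm (disagreement x))\<^sup>2
      + (norm (v - mean_step v *\<^sub>R 1))\<^sup>2 / mean_step v
        * (norm (stacked_gradient f (consensus xm)))\<^sup>2"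
proof (cases "mean_step v = 0")
  case True
  then have "v = 0" by (intro mean_step_zero v)
  then have "ym = 0"
    by (simp add: ym_def block_mean_def block_mix_diag)
  moreover have "0 \<le> \<kappa>" using max True by simp
  ultimately show ?thesis using True L by simp
next
  case False
  define l where "l = mean_step v"
  define M where "M = max_step v"
  define E where "E = (norm (disagreement x))\<^sup>2"
  define H where "H = (norm (v - l *\<^sub>R 1))\<^sup>2"
  define G where "G = stacked_gradient f (consensus xm)"
  define D where "D = gradient (objective f) xm"
  let ?m = "real CARD('m)"
  have l: "l > 0"
    using False v by (auto simp: l_def mean_step_def sum_nonneg less_le)
  have D: "D = block_mean G"
    by (simp add: D_def G_def gradient_objective diff)
  define P where "P = mix (diag_mat v) (stacked_gradient f x - G)"
  define Q where "Q = mix (diag_mat (v - l *\<^sub>R 1)) G"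
  have "mix (diag_mat v) (stacked_gradient f x) - l *\<^sub>R G = P + Q"
    by (rule block_eqI) (simp add: P_def Q_def block_mix_diag algebra_simps)
  then have err: "ym - l *\<^sub>R D = block_mean (P + Q)"
    by (simp add: ym_def D flip: block_mean_diff block_mean_scaleR)
  have "(norm P)\<^sup>2 \<le> M\<^sup>2 * (norm (stacked_gradient f x - G))\<^sup>2"
    unfolding P_def M_def by (rule norm_mix_diag_le) (simp add: v le_max_step)
  also have "\<dots> \<le> M\<^sup>2 * (L\<^sup>2 * E)"
    using norm_stacked_gradient_diff_le[where f = f, OF smooth, of x "consensus xm"]
    by (intro mult_left_mono) (auto simp: G_def E_def disagreement_def xm_def)
  finally have P: "(norm P)\<^sup>2 \<le> M\<^sup>2 * (L\<^sup>2 * E)" .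
  have Q: "(norm Q)\<^sup>2 \<le> H * (norm G)\<^sup>2"
    unfolding Q_def H_def by (rule norm_mix_diag_le) (rule component_le_norm_cart)
  have m1: "1 \<le> ?m" using zero_less_card_finite[where 'a='m] by linarith
  have "(norm (ym - l *\<^sub>R D))\<^sup>2 \<le> (norm (P + Q))\<^sup>2 / ?m"
    unfolding err by (rule norm_block_mean_le)
  also have "\<dots> \<le> (2 * (M\<^sup>2 * (L\<^sup>2 * E)) + 2 * (H * (norm G)\<^sup>2)) / ?m"
    using power2_norm_add_le[of P Q] P Q by (intro divide_right_mono) auto
  also have "\<dots> = 2 * (M\<^sup>2 * (L\<^sup>2 * E)) / ?m + 2 * (H * (norm G)\<^sup>2) / ?m"
    by (rule add_divide_distrib)
  also have "2 * (H * (norm G)\<^sup>2) / ?m \<le> 2 * (H * (norm G)\<^sup>2)"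
    using m1 divide_left_mono[of 1 ?m "2 * (H * (norm G)\<^sup>2)"] by (simp add: H_def)
  finally have "(norm (ym - l *\<^sub>R D))\<^sup>2 / (2 * l)
      \<le> (2 * (M\<^sup>2 * (L\<^sup>2 * E)) / ?m + 2 * (H * (norm G)\<^sup>2)) / (2 * l)"
    using l by (intro divide_right_mono) auto
  also have "\<dots> = L / 2 * (2 * L / (?m * l) * M\<^sup>2) * E + H / l * (norm G)\<^sup>2"
    using l m1 by (simp add: field_simps power2_eq_square)
  also have "L / 2 * (2 * L / (?m * l) * M\<^sup>2) * E \<le> L / 2 * \<kappa> * E"
    using max L by (intro mult_right_mono mult_left_mono) (auto simp: l_def M_def E_def)
  finally have err_le: "(norm (ym - l *\<^sub>R D))\<^sup>2 / (2 * l)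
      \<le> L / 2 * \<kappa> * E + H / l * (norm G)\<^sup>2" by simp
  have "(norm (ym - l *\<^sub>R D))\<^sup>2 = (norm ym)\<^sup>2 - 2 * l * (D \<bullet> ym) + l\<^sup>2 * (norm D)\<^sup>2"
    unfolding power2_norm_eq_inner
    by (simp add: inner_diff_left inner_diff_right inner_commute power2_eq_square)
  then have polar: "- (D \<bullet> ym) = (norm (ym - l *\<^sub>R D))\<^sup>2 / (2 * l)
      - 1 / (2 * l) * (norm ym)\<^sup>2 - l / 2 * (norm D)\<^sup>2"
    using l by (simp add: field_simps power2_eq_square)
  have "objective f (xm - ym) \<le> objective f xm + D \<bullet> (- ym) + L / 2 * (norm ym)\<^sup>2"
    using smooth_upper_bound[where f = "objective f",
        OF objective_differentiable[where f = f, OF diff]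
          gradient_objective_lipschitz[where f = f, OF diff smooth], of "xm - ym" xm]
    by (simp add: D_def)
  with polar err_le have "objective f (xm - ym) \<le> objective f xm
      - l / 2 * (norm D)\<^sup>2 - (1 / (2 * l) * (norm ym)\<^sup>2 - L / 2 * (norm ym)\<^sup>2)
      + L / 2 * \<kappa> * E + H / l * (norm G)\<^sup>2"
    by simp
  then show ?thesis
    by (simp add: l_def H_def G_def D_def E_def left_diff_distrib)
qed

lemma displacement_bound:
  fixes x y :: "real^('m::finite \<times> 'd::finite)"
  assumes W: "1 v* W = 1" "W *v 1 = 1"
  shows "(norm (mix W x - y - x))\<^sup>2
    \<le> 2 * (spectral_norm (W - mat 1))\<^sup>2 * (norm (disagreement x))\<^sup>2
      + 2 * (norm (disagreement y))\<^sup>2 + real CARD('m) * (norm (block_mean y))\<^sup>2"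
proof -
  let ?d = "mix (W - mat 1) (disagreement x)"
  have "block_mean (mix W x - y - x) = - block_mean y"
    by (simp add: block_mean_diff block_mean_mix W)
  moreover have "?d = mix W x - x"
    by (simp add: mix_diff_left mix_mat_1 disagreement_def matrix_vector_mult_diff_distrib
        mix_consensus W)
  then have "disagreement (mix W x - y - x) = ?d + - disagreement y"
    by (simp add: disagreement_def block_mean_diff block_mean_mix W)
      (auto intro!: block_eqI)
  moreover have "(norm (?d + - disagreement y))\<^sup>2
      \<le> 2 * (norm ?d)\<^sup>2 + 2 * (norm (disagreement y))\<^sup>2"
    using power2_norm_add_le[of ?d "- disagreement y"] by simp
  moreover have "(norm ?d)\<^sup>2 \<le> (spectral_norm (W - mat 1) * norm (disagreement x))\<^sup>2"
    by (intro power_mono norm_mix_le) simp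
  ultimately show ?thesis
    using norm_square_split[of "mix W x - y - x"] by (simp add: power_mult_distrib)
qed

text \<open>The two causes of a change of the scaled gradients are separated: the moving gradients, with the
  stepsizes held at the new value, and the moving stepsizes, with the gradients held at the old value.
  Only the second is not proportional to the motion of the iterates; the assumption of summable
  squared stepsize variation is for it.\<close>

lemma tracked_change_bound:
  fixes g g' :: "real^('m::finite \<times> 'd::finite)"
  assumes "column_stochastic A"
  shows "(norm (mix A (mix (diag_mat v') g' - mix (diag_mat v) g)))\<^sup>2
    \<le> real CARD('m) * (2 * (norm v')\<^sup>2 * (norm (g' - g))\<^sup>2 + 2 * (norm (v' - v))\<^sup>2 * (norm g)\<^sup>2)"
proof -
  have "mix (diag_mat v') g' - mix (diag_mat v) g
      = mix (diag_mat v') (g' - g) + mix (diag_mat (v' - v)) g"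
    by (rule block_eqI) (simp add: block_mix_diag algebra_simps)
  moreover have "(norm (mix (diag_mat v') (g' - g)))\<^sup>2 \<le> (norm v')\<^sup>2 * (norm (g' - g))\<^sup>2"
    "(norm (mix (diag_mat (v' - v)) g))\<^sup>2 \<le> (norm (v' - v))\<^sup>2 * (norm g)\<^sup>2"
    by (rule norm_mix_diag_le, rule component_le_norm_cart)+
  ultimately have "(norm (mix (diag_mat v') g' - mix (diag_mat v) g))\<^sup>2
      \<le> 2 * (norm v')\<^sup>2 * (norm (g' - g))\<^sup>2 + 2 * (norm (v' - v))\<^sup>2 * (norm g)\<^sup>2"
    using power2_norm_add_le[of "mix (diag_mat v') (g' - g)" "mix (diag_mat (v' - v)) g"] by simp
  then show ?thesis
    using norm_mix_column_stochastic_le[OF assms, of "mix (diag_mat v') g' - mix (diag_mat v) g"]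
    by (meson mult_left_mono of_nat_0_le_iff order_trans)
qed

text \<open>The weights \<open>a\<close> and \<open>b\<close> of the disagreements \<open>X\<close> of \<open>x\<close> and \<open>Z\<close> of \<open>y\<close> are chosen such that each
  of \<open>X\<close>, \<open>Z\<close> and the squared mean \<open>Y\<close> of \<open>y\<close> gets a strictly negative total coefficient. With
  \<open>a = L / (2 \<delta>)\<close> the contraction of \<open>X\<close> outweighs its contribution \<open>L (1 - \<eta>) / 2\<close> to the descent
  of the objective by \<open>(1 - \<eta>) (1 - \<delta>) a\<close>, and the factor \<open>5 / 4\<close> in \<open>b\<close> makes the contraction of
  \<open>Z\<close>, whose rate including its feedback through the gradients is \<open>c\<close>, outweigh its contribution
  \<open>a / (1 - \<eta>)\<close> through \<open>X\<close>. What \<open>X\<close> and \<open>Y\<close> contribute through \<open>Z\<close> is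
  at most \<open>5 / 6\<close> of the first margin and \<open>5 / 12\<close> of \<open>a\<close>. The variable \<open>\<Lambda>\<close> is the squared norm of the next
  stepsize vector; \<open>N\<close>, \<open>R\<close> and \<open>S\<close> are the terms that are only carried along.\<close>

lemma lyapunov_decrease:
  fixes m L \<eta> r c \<delta> l \<Lambda> :: real
  assumes m: "1 \<le> m" and L: "0 < L" and \<eta>: "0 \<le> \<eta>" "\<eta> < 1" and c: "c < 1"
    and \<delta>: "0 < \<delta>" "\<delta> < 1" and l: "0 \<le> l" "l * L \<le> \<delta> / (1 + \<delta>)"
    and \<Lambda>: "0 \<le> \<Lambda>" "\<eta> + 6 * m\<^sup>2 * L\<^sup>2 / (1 - \<eta>) * \<Lambda> \<le> c"
      "max (m^3 * r\<^sup>2) (m\<^sup>2) * 6 * L\<^sup>2 * \<Lambda> \<le> (1 - \<eta>)^3 * (1 - c) * (1 - \<delta>)"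
    and nonneg: "0 \<le> X" "0 \<le> Z" "0 \<le> Y" and Y: "l = 0 \<Longrightarrow> Y = 0"
    and \<Phi>': "\<Phi>' \<le> \<Phi> - N - (1 / (2 * l) - L / 2) * Y + L * (1 - \<eta>) / 2 * X + R"
    and X': "X' \<le> \<eta> * X + Z / (1 - \<eta>)"
    and Z': "Z' \<le> \<eta> * Z + m * (2 * \<Lambda> * (L\<^sup>2 * (2 * r\<^sup>2 * X + 2 * Z + m * Y)) + S) / (1 - \<eta>)"
  defines "a \<equiv> L / (2 * \<delta>)"
  defines "b \<equiv> 5 * a / (4 * (1 - \<eta>) * (1 - c))"
  shows "\<Phi>' + a * X' + b * Z' \<le> \<Phi> + a * X + b * Z
    - (N + Y / (8 * l) + (1 - \<eta>) * (1 - \<delta>) * a / 6 * X + a / (4 * (1 - \<eta>)) * Z)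
    + R + b * m / (1 - \<eta>) * S"
proof -
  define e where "e = 1 - \<eta>"
  have e: "0 < e" "e \<le> 1" using \<eta> by (auto simp: e_def)
  have a: "0 < a" using L \<delta> by (simp add: a_def)
  have b: "0 < b" using a e c by (simp add: b_def e_def)
  have b_eq: "b * (e * (1 - c)) = 5 / 4 * a"
  proof -
    have "b = 5 * a / (4 * e * (1 - c))" by (simp add: b_def e_def)
    then show ?thesis using e c by (simp add: divide_eq_eq)
  qed
  have Lm: "m * L\<^sup>2 * \<Lambda> \<le> m\<^sup>2 * L\<^sup>2 * \<Lambda>"
    using m \<Lambda> by (intro mult_right_mono) (auto simp: power2_eq_square)
  have m3: "m \<le> m^3" using m power_increasing[of 1 3 m] by simp
  have K: "m^3 * r\<^sup>2 * 6 * L\<^sup>2 * \<Lambda> \<le> e^3 * (1 - c) * (1 - \<delta>)"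
    "m\<^sup>2 * 6 * L\<^sup>2 * \<Lambda> \<le> e^3 * (1 - c) * (1 - \<delta>)"
    unfolding e_def
    by (rule order_trans[OF _ \<Lambda>(3)], use \<Lambda>(1) in \<open>intro mult_right_mono; simp\<close>)+
  \<comment> \<open>the bound in the last stepsize condition, fed back through \<open>Z\<close> with weight \<open>b\<close>, amounts to
    \<open>5 / 4\<close> of the margin of \<open>X\<close>\<close>
  have bK: "b / e * (e^3 * (1 - c) * (1 - \<delta>)) = 5 / 4 * (a * e * (1 - \<delta>))"
  proof -
    have "b / e * (e^3 * (1 - c) * (1 - \<delta>)) = b * (e * (1 - c)) * (e * (1 - \<delta>))"
      using e by (simp add: power3_eq_cube)
    then show ?thesis unfolding b_eq by (simp add: mult.assoc)
  qed
  have ex: "b / e * (m * 4 * r\<^sup>2 * L\<^sup>2 * \<Lambda>) \<le> 5 / 6 * (a * e * (1 - \<delta>))"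
  proof -
    have "m * (4 * r\<^sup>2 * L\<^sup>2 * \<Lambda>) \<le> m^3 * (4 * r\<^sup>2 * L\<^sup>2 * \<Lambda>)"
      using m3 \<Lambda> by (intro mult_right_mono) auto
    with K(1) have "m * 4 * r\<^sup>2 * L\<^sup>2 * \<Lambda> \<le> 2 / 3 * (e^3 * (1 - c) * (1 - \<delta>))"
      by (simp add: mult_ac)
    then have "b / e * (m * 4 * r\<^sup>2 * L\<^sup>2 * \<Lambda>) \<le> b / e * (2 / 3 * (e^3 * (1 - c) * (1 - \<delta>)))"
      using b e by (intro mult_left_mono) auto
    also have "\<dots> = 2 / 3 * (b / e * (e^3 * (1 - c) * (1 - \<delta>)))"
      by (rule mult.left_commute)
    finally show ?thesis unfolding bK by simp
  qed
  have y: "b / e * (m\<^sup>2 * 2 * L\<^sup>2 * \<Lambda>) \<le> 5 / 12 * a"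
  proof -
    have "m\<^sup>2 * 2 * L\<^sup>2 * \<Lambda> \<le> 1 / 3 * (e^3 * (1 - c) * (1 - \<delta>))"
      using K(2) by (simp add: mult_ac)
    then have "b / e * (m\<^sup>2 * 2 * L\<^sup>2 * \<Lambda>) \<le> b / e * (1 / 3 * (e^3 * (1 - c) * (1 - \<delta>)))"
      using b e by (intro mult_left_mono) auto
    also have "\<dots> = 1 / 3 * (b / e * (e^3 * (1 - c) * (1 - \<delta>)))"
      by (rule mult.left_commute)
    finally have "b / e * (m\<^sup>2 * 2 * L\<^sup>2 * \<Lambda>) \<le> 5 / 12 * (a * e * (1 - \<delta>))"
      unfolding bK by simp
    also have "a * e * (1 - \<delta>) \<le> a * 1 * 1"
      using a e \<delta> by (intro mult_mono) auto
    finally show ?thesis by simp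
  qed
  have ey: "b * \<eta> + b / e * (m * 4 * L\<^sup>2 * \<Lambda>) + a / e \<le> b - a / (4 * e)"
  proof -
    have "4 * (m * L\<^sup>2 * \<Lambda>) \<le> 6 * (m\<^sup>2 * L\<^sup>2 * \<Lambda>)"
      using Lm \<Lambda>(1) m by (smt (verit) zero_le_mult_iff zero_le_power2)
    then have "(m * 4 * L\<^sup>2 * \<Lambda>) / e \<le> 6 * m\<^sup>2 * L\<^sup>2 / (1 - \<eta>) * \<Lambda>"
      using e divide_right_mono[of "4 * (m * L\<^sup>2 * \<Lambda>)" "6 * (m\<^sup>2 * L\<^sup>2 * \<Lambda>)" e]
      by (simp add: e_def mult_ac)
    with \<Lambda>(2) have "\<eta> + (m * 4 * L\<^sup>2 * \<Lambda>) / e \<le> c" by linarith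
    from mult_left_mono[OF this, of b] b
    have "b * \<eta> + b / e * (m * 4 * L\<^sup>2 * \<Lambda>) \<le> b * c" by (simp add: distrib_left)
    moreover have "b * c = b - 5 / 4 * (a / e)"
      using b_eq e by (simp add: field_simps)
    moreover have "a / (4 * e) = a / e / 4" by simp
    ultimately show ?thesis by linarith
  qed
  \<comment> \<open>the stepsize bound gives \<open>1 / (2 l) - L / 2 \<ge> 1 / (2 l (1 + \<delta>)) \<ge> a\<close>, of which
    \<open>5 / 12\<close> is spent and the rest is at least \<open>1 / (8 l)\<close>\<close>
  have yl: "5 / 12 * a * Y + Y / (8 * l) \<le> (1 / (2 * l) - L / 2) * Y"
  proof (cases "l = 0")
    case False
    then have l0: "0 < l" using l by simp
    have "a * l * (1 + \<delta>) \<le> 1 / 2"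
      using l(2) \<delta> by (simp add: a_def field_simps)
    moreover have "L * l * (1 + \<delta>) \<le> \<delta>"
      using l(2) \<delta> by (simp add: field_simps)
    ultimately have "5 / 12 * (a * l * (1 + \<delta>)) + 1 / 2 * (L * l * (1 + \<delta>)) \<le> 3 / 8 * (1 + \<delta>)"
      using \<delta> by argo
    then have "(5 / 12 * a * l + L / 2 * l) * (1 + \<delta>) \<le> 3 / 8 * (1 + \<delta>)"
      by (simp add: field_simps)
    then have "5 / 12 * a * l + L / 2 * l \<le> 3 / 8"
      by (rule mult_right_le_imp_le) (use \<delta> in simp)
    from divide_right_mono[OF this, of l] have "5 / 12 * a + L / 2 \<le> 3 / (8 * l)"
      using l0 by (simp add: add_divide_distrib)
    moreover have "1 / (2 * l) = 3 / (8 * l) + 1 / (8 * l)"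
      using l0 by (simp add: field_simps)
    ultimately have "5 / 12 * a + 1 / (8 * l) \<le> 1 / (2 * l) - L / 2" by linarith
    from mult_right_mono[OF this nonneg(3)] show ?thesis by (simp add: distrib_right)
  qed (use Y in simp)
  have "\<Phi>' + a * X' + b * Z' \<le> (\<Phi> - N - (1 / (2 * l) - L / 2) * Y + L * e / 2 * X + R)
      + a * (\<eta> * X + Z / e)
      + b * (\<eta> * Z + m * (2 * \<Lambda> * (L\<^sup>2 * (2 * r\<^sup>2 * X + 2 * Z + m * Y)) + S) / e)"
    using \<Phi>' X' Z' a b unfolding e_def by (intro add_mono mult_left_mono) auto
  also have "\<dots> = \<Phi> - N - (1 / (2 * l) - L / 2) * Y + R + b * m / e * S
      + (L * e / 2 + a * \<eta> + b / e * (m * 4 * r\<^sup>2 * L\<^sup>2 * \<Lambda>)) * X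
      + (b * \<eta> + b / e * (m * 4 * L\<^sup>2 * \<Lambda>) + a / e) * Z
      + b / e * (m\<^sup>2 * 2 * L\<^sup>2 * \<Lambda>) * Y"
    by (simp add: add_divide_distrib distrib_left distrib_right power2_eq_square mult_ac)
  also have "L * e / 2 = a * \<delta> * e"
    using \<delta> by (simp add: a_def)
  also have "(a * \<delta> * e + a * \<eta> + b / e * (m * 4 * r\<^sup>2 * L\<^sup>2 * \<Lambda>)) * X
      \<le> (a - e * (1 - \<delta>) * a / 6) * X"
  proof (rule mult_right_mono[OF _ nonneg(1)])
    have "a * \<delta> * e + a * \<eta> + 5 / 6 * (a * e * (1 - \<delta>)) = a - e * (1 - \<delta>) * a / 6"
      by (simp add: e_def field_simps)
    with ex show "a * \<delta> * e + a * \<eta> + b / e * (m * 4 * r\<^sup>2 * L\<^sup>2 * \<Lambda>) \<le> a - e * (1 - \<delta>) * a / 6"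
      by linarith
  qed
  also have "(b * \<eta> + b / e * (m * 4 * L\<^sup>2 * \<Lambda>) + a / e) * Z \<le> (b - a / (4 * e)) * Z"
    by (rule mult_right_mono[OF ey nonneg(2)])
  also have "b / e * (m\<^sup>2 * 2 * L\<^sup>2 * \<Lambda>) * Y \<le> 5 / 12 * a * Y"
    by (rule mult_right_mono[OF y nonneg(3)])
  finally show ?thesis
    using yl unfolding e_def by (simp add: left_diff_distrib)
qed

section \<open>Convergence of the method\<close>

text \<open>The second-order recursion is a first-order recursion for the pair \<open>(x, y)\<close>. In the second
  component the column sums of \<open>B k\<close> and \<open>W\<close> preserve means, so the increments of the mean of \<open>y\<close>
  telescope to the mean of the current scaled gradients.\<close>

lemma
  fixes x :: "nat \<Rightarrow> real^('m::finite \<times> 'd::finite)"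
  assumes W: "1 v* W = 1" and B: "\<And>k. column_stochastic (B k)"
    and it: "PDG_NDS W B lam f x"
  shows auxiliary_Suc: "auxiliary W x (Suc k) = mix W (auxiliary W x k)
      + mix (B k) (mix (diag_mat (lam (Suc k))) (stacked_gradient f (x (Suc k)))
        - mix (diag_mat (lam k)) (stacked_gradient f (x k)))" (is "?step k")
    and block_mean_auxiliary: "block_mean (auxiliary W x k)
      = block_mean (mix (diag_mat (lam k)) (stacked_gradient f (x k)))"
proof -
  let ?g = "\<lambda>k. stacked_gradient f (x k)"
  show step: "?step k" for k
  proof -
    have "x (Suc (Suc k)) = 2 *\<^sub>R mix W (x (Suc k)) - mix (W ** W) (x k)
        - (mix (B k ** diag_mat (lam (Suc k))) (?g (Suc k)) - mix (B k ** diag_mat (lam k)) (?g k))"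
      using it unfolding PDG_NDS_def by simp
    then show ?thesis
      by (simp add: auxiliary_def mix_matrix_mult matrix_vector_mult_diff_distrib scaleR_2)
  qed
  show "block_mean (auxiliary W x k) = block_mean (mix (diag_mat (lam k)) (?g k))"
  proof (induction k)
    case 0
    have "x 1 = mix W (x 0) - mix (diag_mat (lam 0)) (?g 0)"
      using it unfolding PDG_NDS_def by blast
    then show ?case by (simp add: auxiliary_def)
  next
    case (Suc k)
    then show ?case
      by (simp add: step block_mean_add block_mean_diff W
          block_mean_mix[OF column_stochastic_left_eigenvector[OF B]] block_mean_mix[OF W])
  qed
qed

theorem theorem3:
  fixes W :: "real^'m^'m"
    and B :: "nat \<Rightarrow> real^'m^'m"
    and lam :: "nat \<Rightarrow> real^'m"
    and f :: "'m \<Rightarrow> real^'d \<Rightarrow> real"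
    and x :: "nat \<Rightarrow> real^('m \<times> 'd)"
    and \<theta>opt :: "real^'d"
    and \<eta> r L \<delta> c m :: real
    and T :: nat
  assumes m_eq: "m = real CARD('m)"
    and weights: "interaction_weights W"
    and W_left: "1 v* W = 1"
    and W_right: "W *v 1 = 1"
    and eta_eq: "\<eta> = spectral_norm (W - averaging_matrix)"
    and eta_less: "\<eta> < 1"
    and r_eq: "r = spectral_norm (W - mat 1)"
    and B_stoch: "\<And>k. column_stochastic (B k)"
    and optimal: "\<And>\<theta>. objective f \<theta>opt \<le> objective f \<theta>"
    and convex: "\<And>i. convex_on UNIV (f i)"
    and diff: "\<And>i u. f i differentiable (at u)"
    and L_pos: "0 < L"
    and smooth: "\<And>i u v. norm (gradient (f i) u - gradient (f i) v) \<le> L * norm (u - v)"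
    and step_nonneg: "\<And>k i. 0 \<le> lam k $ i"
    and delta: "0 < \<delta>" "\<delta> < 1"
    and c: "0 < c" "c < 1"
    and sum_mean: "filterlim (\<lambda>n. \<Sum>k=T..n. mean_step (lam k)) at_top sequentially"
    and sum_variation: "summable (\<lambda>k. (norm (lam (k + T + 1) - lam (k + T)))\<^sup>2)"
    and sum_heterogeneity:
      "summable (\<lambda>k. (norm (lam (k + T) - mean_step (lam (k + T)) *\<^sub>R 1))\<^sup>2
                      / mean_step (lam (k + T)))"
    and cond1: "\<And>k. T \<le> k \<Longrightarrow>
      2 * L / (m * mean_step (lam k)) * (max_step (lam k))\<^sup>2 \<le> 1 - \<eta>"
    and cond2: "\<And>k. T \<le> k \<Longrightarrow> mean_step (lam k) * L \<le> \<delta> / (1 + \<delta>)"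
    and cond3: "\<And>k. T \<le> k \<Longrightarrow>
      \<eta> + 6 * m^2 * L^2 / (1 - \<eta>) * (norm (lam (k + 1)))\<^sup>2 \<le> c"
    and cond4: "\<And>k. T \<le> k \<Longrightarrow>
      max (m^3 * r^2) (m^2) * 6 * L^2 * (norm (lam (k + 1)))\<^sup>2
        \<le> (1 - \<eta>)^3 * (1 - c) * (1 - \<delta>)"
    and iterates: "PDG_NDS W B lam f x"
  shows
    "(convergent (\<lambda>k. objective f (block_mean (x k)))
      \<and> (\<lambda>k. norm (block_mean (auxiliary W x k))) \<longlonglongrightarrow> 0
      \<and> (\<forall>i. (\<lambda>k. norm (block (x k) i - block_mean (x k))) \<longlonglongrightarrow> 0)
      \<and> (\<forall>i. (\<lambda>k. norm (block (auxiliary W x k) i - block_mean (auxiliary W x k))) \<longlonglongrightarrow> 0))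
    \<and> ((\<lambda>k. norm (gradient (objective f) (block_mean (x k)))) \<longlonglongrightarrow> 0
      \<and> (bounded (range (\<lambda>k. block_mean (x k))) \<longrightarrow>
          (\<forall>p. (\<exists>s. strict_mono s \<and> (\<lambda>n. block_mean (x (s n))) \<longlonglongrightarrow> p) \<longrightarrow>
               (\<forall>\<theta>. objective f p \<le> objective f \<theta>))
          \<and> (\<forall>i. (\<lambda>k. objective f (block (x k) i)) \<longlonglongrightarrow> objective f \<theta>opt)))"
proof -
  have m1: "1 \<le> m" using zero_less_card_finite[where 'a='m] unfolding m_eq by linarith
  have \<eta>0: "0 \<le> \<eta>" unfolding eta_eq by (rule spectral_norm_nonneg)
  define F where "F = objective f"
  define xm where "xm k = block_mean (x k)" for k
  define y where "y = auxiliary W x"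
  define ym where "ym k = block_mean (y k)" for k
  define g where "g k = stacked_gradient f (x k)" for k
  define \<Phi> where "\<Phi> k = F (xm k) - F \<theta>opt" for k
  define X where "X k = (norm (disagreement (x k)))\<^sup>2" for k
  define Z where "Z k = (norm (disagreement (y k)))\<^sup>2" for k
  define Y where "Y k = (norm (ym k))\<^sup>2" for k
  define N where "N k = (norm (gradient F (xm k)))\<^sup>2" for k
  define l where "l k = mean_step (lam k)" for k
  define h where "h k = (norm (lam k - l k *\<^sub>R 1))\<^sup>2 / l k" for k
  define q where "q k = (norm (lam (Suc k) - lam k))\<^sup>2" for k
  define G where "G = (norm (stacked_gradient f (consensus \<theta>opt)))\<^sup>2"
  have F_diff: "F differentiable (at u)" for u
    unfolding F_def by (rule objective_differentiable) (rule diff)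
  have F_smooth: "norm (gradient F u - gradient F v) \<le> L * norm (u - v)" for u v
    unfolding F_def by (rule gradient_objective_lipschitz[OF diff smooth])
  have F_min: "F \<theta>opt \<le> F u" for u unfolding F_def by (rule optimal)
  have l0: "0 \<le> l k" for k
    by (simp add: l_def mean_step_def sum_nonneg step_nonneg)
  have h0: "0 \<le> h k" and q0: "0 \<le> q k" for k by (simp_all add: h_def q_def l0)
  have \<Phi>0: "0 \<le> \<Phi> k" for k using F_min by (simp add: \<Phi>_def)
  have x_Suc: "x (Suc k) = mix W (x k) - y k" for k
    by (simp add: y_def auxiliary_def)
  have xm_Suc: "xm (Suc k) = xm k - ym k" for k
    by (simp add: xm_def x_Suc block_mean_diff block_mean_mix W_left ym_def)
  have ym: "ym k = block_mean (mix (diag_mat (lam k)) (g k))" for k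
    unfolding ym_def y_def g_def by (rule block_mean_auxiliary[OF W_left B_stoch iterates])
  have Y_zero: "Y k = 0" if "l k = 0" for k
  proof -
    have "lam k = 0" using that step_nonneg mean_step_zero unfolding l_def by blast
    then show ?thesis by (simp add: Y_def ym block_mean_def block_mix_diag)
  qed

  define \<Gamma> where "\<Gamma> k = (norm (stacked_gradient f (consensus (xm k))))\<^sup>2" for k
  have \<Gamma>_le: "\<Gamma> k \<le> 4 * L * m * \<Phi> k + 2 * G" for k
    unfolding \<Gamma>_def \<Phi>_def G_def F_def m_eq
    by (rule gradients_bounded_by_gap[OF convex diff L_pos smooth optimal])
  have g_le: "(norm (g k))\<^sup>2 \<le> 2 * L\<^sup>2 * X k + 2 * \<Gamma> k" for k
    unfolding g_def X_def \<Gamma>_def xm_def by (rule norm_stacked_gradient_le[OF smooth])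

  define a where "a = L / (2 * \<delta>)"
  define b where "b = 5 * a / (4 * (1 - \<eta>) * (1 - c))"
  have a: "0 < a" using L_pos delta by (simp add: a_def)
  have b: "0 < b" using a c eta_less by (simp add: b_def)
  \<comment> \<open>the Lyapunov function and its guaranteed decrease\<close>
  define V where "V k = \<Phi> k + a * X k + b * Z k" for k
  define D where "D k = l k / 2 * N k + Y k / (8 * l k)
      + (1 - \<eta>) * (1 - \<delta>) * a / 6 * X k + a / (4 * (1 - \<eta>)) * Z k" for k
  have X0: "0 \<le> X k" and Z0: "0 \<le> Z k" and Y0: "0 \<le> Y k" and N0: "0 \<le> N k" for k
    by (simp_all add: X_def Z_def Y_def N_def)

  have decrease: "V (Suc k) \<le> V k - D k + h k * \<Gamma> k + b * m / (1 - \<eta>) * (2 * q k * (norm (g k))\<^sup>2)"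
    if k: "T \<le> k" for k
    unfolding V_def D_def a_def b_def
  proof (rule lyapunov_decrease[where r = r and c = c and \<Lambda> = "(norm (lam (Suc k)))\<^sup>2"])
    show "l k * L \<le> \<delta> / (1 + \<delta>)" unfolding l_def by (rule cond2[OF k])
    show "\<eta> + 6 * m\<^sup>2 * L\<^sup>2 / (1 - \<eta>) * (norm (lam (Suc k)))\<^sup>2 \<le> c"
      using cond3[OF k] by simp
    show "max (m ^ 3 * r\<^sup>2) (m\<^sup>2) * 6 * L\<^sup>2 * (norm (lam (Suc k)))\<^sup>2 \<le> (1 - \<eta>) ^ 3 * (1 - c) * (1 - \<delta>)"
      using cond4[OF k] by simp
    show "\<Phi> (Suc k) \<le> \<Phi> k - l k / 2 * N k - (1 / (2 * l k) - L / 2) * Y k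
        + L * (1 - \<eta>) / 2 * X k + h k * \<Gamma> k"
      using mean_descent[where f = f, OF diff L_pos smooth step_nonneg cond1[OF k, unfolded m_eq], of "x k"]
      unfolding \<Phi>_def xm_Suc ym Y_def
      unfolding g_def N_def X_def h_def \<Gamma>_def l_def F_def xm_def
      by linarith
    have "X (Suc k) \<le> \<eta> * X k + (norm (disagreement (- y k)))\<^sup>2 / (1 - \<eta>)"
      using disagreement_contraction[OF W_left W_right eta_eq eta_less, of "x k" "- y k"]
      by (simp add: X_def x_Suc)
    then show "X (Suc k) \<le> \<eta> * X k + Z k / (1 - \<eta>)"
      by (simp add: Z_def disagreement_minus)
    define w where "w = mix (B k) (mix (diag_mat (lam (Suc k))) (g (Suc k)) - mix (diag_mat (lam k)) (g k))"
    have y_Suc: "y (Suc k) = mix W (y k) + w"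
      unfolding y_def w_def g_def by (rule auxiliary_Suc[OF W_left B_stoch iterates])
    have "(norm (g (Suc k) - g k))\<^sup>2 \<le> L\<^sup>2 * (norm (x (Suc k) - x k))\<^sup>2"
      unfolding g_def by (rule norm_stacked_gradient_diff_le[OF smooth])
    also have "\<dots> \<le> L\<^sup>2 * (2 * r\<^sup>2 * X k + 2 * Z k + m * Y k)"
      using displacement_bound[OF W_left W_right, of "x k" "y k"]
      by (intro mult_left_mono) (simp_all add: x_Suc X_def Z_def Y_def ym_def m_eq r_eq)
    finally have dg: "(norm (g (Suc k) - g k))\<^sup>2 \<le> L\<^sup>2 * (2 * r\<^sup>2 * X k + 2 * Z k + m * Y k)" .
    have "(norm (disagreement w))\<^sup>2 \<le> (norm w)\<^sup>2" by (rule norm_disagreement_le)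
    also have "\<dots> \<le> m * (2 * (norm (lam (Suc k)))\<^sup>2 * (norm (g (Suc k) - g k))\<^sup>2 + 2 * q k * (norm (g k))\<^sup>2)"
      unfolding w_def q_def m_eq by (rule tracked_change_bound[OF B_stoch])
    also have "\<dots> \<le> m * (2 * (norm (lam (Suc k)))\<^sup>2 * (L\<^sup>2 * (2 * r\<^sup>2 * X k + 2 * Z k + m * Y k))
        + 2 * q k * (norm (g k))\<^sup>2)"
      using m1 dg by (intro mult_left_mono add_right_mono) auto
    finally show "Z (Suc k) \<le> \<eta> * Z k + m * (2 * (norm (lam (Suc k)))\<^sup>2
        * (L\<^sup>2 * (2 * r\<^sup>2 * X k + 2 * Z k + m * Y k)) + 2 * q k * (norm (g k))\<^sup>2) / (1 - \<eta>)"
      using disagreement_contraction[OF W_left W_right eta_eq eta_less, of "y k" w] eta_less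
      by (simp add: Z_def y_Suc) (smt (verit) divide_right_mono)
  qed (use m1 L_pos \<eta>0 eta_less c delta l0 X0 Z0 Y0 Y_zero in auto)

  \<comment> \<open>the squared gradient norms are at most \<open>C (V + 1)\<close>, so the remaining terms fit the form
    \<open>s V + s\<close> with summable \<open>s\<close>\<close>
  define C where "C = 2 * L\<^sup>2 / a + 8 * L * m + 4 * G"
  define p where "p = b * m / (1 - \<eta>) * 2"
  define s where "s k = C * h k + C * p * q k" for k
  have C0: "0 \<le> C" using a L_pos m1 by (simp add: C_def G_def)
  have p0: "0 \<le> p" using b m1 eta_less by (simp add: p_def)
  have V0: "0 \<le> V k" for k using \<Phi>0 a b X0 Z0 by (simp add: V_def)
  have V_ge: "\<Phi> k \<le> V k" "a * X k \<le> V k" for k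
    using \<Phi>0[of k] mult_nonneg_nonneg[of a "X k"] mult_nonneg_nonneg[of b "Z k"] a b X0[of k] Z0[of k]
    by (auto simp: V_def)
  have grad_le: "2 * L\<^sup>2 * X k + 2 * \<Gamma> k \<le> C * (V k + 1)" for k
  proof -
    have "2 * L\<^sup>2 * X k = 2 * L\<^sup>2 / a * (a * X k)" using a by simp
    also have "\<dots> \<le> 2 * L\<^sup>2 / a * (V k + 1)"
      using V_ge(2)[of k] a by (intro mult_left_mono) auto
    finally have "2 * L\<^sup>2 * X k \<le> 2 * L\<^sup>2 / a * (V k + 1)" .
    moreover have "8 * L * m * \<Phi> k \<le> 8 * L * m * (V k + 1)"
      using V_ge(1)[of k] L_pos m1 by (intro mult_left_mono) auto
    moreover have "4 * G * 1 \<le> 4 * G * (V k + 1)"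
      using V0[of k] by (intro mult_left_mono) (auto simp: G_def)
    ultimately show ?thesis
      using \<Gamma>_le[of k] unfolding C_def by (simp add: distrib_right)
  qed
  have RS: "V (Suc (k + T)) \<le> (1 + s (k + T)) * V (k + T) + s (k + T) - D (k + T)" for k
  proof -
    let ?k = "k + T"
    have "0 \<le> 2 * L\<^sup>2 * X ?k" "0 \<le> \<Gamma> ?k"
      by (simp_all add: X0 \<Gamma>_def)
    then have "\<Gamma> ?k \<le> C * (V ?k + 1)" using grad_le[of ?k] by linarith
    then have "h ?k * \<Gamma> ?k \<le> h ?k * (C * (V ?k + 1))"
      by (rule mult_left_mono[OF _ h0])
    moreover have "p * q ?k * (norm (g ?k))\<^sup>2 \<le> p * q ?k * (C * (V ?k + 1))"
      using grad_le[of ?k] g_le[of ?k] by (intro mult_left_mono mult_nonneg_nonneg[OF p0 q0]) simp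
    moreover have "V (Suc ?k) \<le> V ?k - D ?k + h ?k * \<Gamma> ?k + p * q ?k * (norm (g ?k))\<^sup>2"
      using decrease[of ?k] by (simp add: p_def mult.assoc)
    ultimately show ?thesis
      by (simp add: s_def algebra_simps)
  qed
  have sum_h: "summable (\<lambda>k. h (k + T))"
    using sum_heterogeneity by (simp add: h_def l_def)
  have sum_q: "summable (\<lambda>k. q (k + T))"
    using sum_variation by (simp add: q_def)
  have sum_s: "summable (\<lambda>k. s (k + T))"
    unfolding s_def by (intro summable_add summable_mult sum_h sum_q)
  have s0: "0 \<le> s k" for k
    unfolding s_def using C0 p0 h0[of k] q0[of k] by (intro add_nonneg_nonneg mult_nonneg_nonneg) auto
  have D_terms: "0 \<le> l k / 2 * N k" "0 \<le> Y k / (8 * l k)"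
      "0 \<le> (1 - \<eta>) * (1 - \<delta>) * a / 6 * X k" "0 \<le> a / (4 * (1 - \<eta>)) * Z k" for k
    using l0[of k] N0[of k] Y0[of k] X0[of k] Z0[of k] a eta_less delta by auto
  have D0: "0 \<le> D k" for k unfolding D_def by (intro add_nonneg_nonneg D_terms)
  have sum_D: "summable (\<lambda>k. D (k + T))" and conv_V: "convergent (\<lambda>k. V (k + T))"
    using robbins_siegmund_deterministic[of "\<lambda>k. V (k + T)" "\<lambda>k. s (k + T)" "\<lambda>k. s (k + T)" "\<lambda>k. D (k + T)"]
      RS V0 s0 D0 sum_s by auto
  have sum_part: "summable (\<lambda>k. u (k + T))"
    if "\<And>k. 0 \<le> u k" "\<And>k. C' * u k \<le> D k" "0 < C'" for u and C' :: real
  proof (rule summable_comparison_test'[OF summable_mult[OF sum_D, of "1 / C'"], of 0])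
    fix k
    show "norm (u (k + T)) \<le> 1 / C' * D (k + T)"
      using that(1)[of "k + T"] that(2)[of "k + T"] that(3) by (simp add: field_simps)
  qed
  have D_ge: "l k / 2 * N k \<le> D k" "Y k / (8 * l k) \<le> D k"
      "(1 - \<eta>) * (1 - \<delta>) * a / 6 * X k \<le> D k" "a / (4 * (1 - \<eta>)) * Z k \<le> D k" for k
    using D_terms[of k] unfolding D_def by linarith+
  have sum_X: "summable (\<lambda>k. X (k + T))"
    by (rule sum_part[OF X0 D_ge(3)]) (use a eta_less delta in simp)
  have sum_Z: "summable (\<lambda>k. Z (k + T))"
    by (rule sum_part[OF Z0 D_ge(4)]) (use a eta_less in simp)
  have sum_N: "summable (\<lambda>k. l (k + T) * N (k + T))"
    by (rule sum_part[of "\<lambda>k. l k * N k" "1 / 2"]) (use l0 N0 D_ge(1) in simp_all)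
  have sum_Yl: "summable (\<lambda>k. Y (k + T) / l (k + T))"
    by (rule sum_part[of "\<lambda>k. Y k / l k" "1 / 8"]) (use l0 Y0 D_ge(2) in simp_all)
  \<comment> \<open>the mean stepsize is at most \<open>1 / L\<close>\<close>
  have Y_le: "L * Y k \<le> Y k / l k" if "T \<le> k" for k
  proof (cases "l k = 0")
    case False
    have "\<delta> / (1 + \<delta>) \<le> 1" using delta by simp
    then have "l k * L \<le> 1" using cond2[OF that] by (simp add: l_def)
    from mult_right_mono[OF this Y0[of k]] show ?thesis
      using False l0[of k] by (simp add: field_simps)
  qed (simp add: Y_zero)
  have sum_Y: "summable (\<lambda>k. L * Y (k + T))"
    by (rule summable_comparison_test'[OF sum_Yl, of 0]) (use Y_le Y0 L_pos in auto)
  have X_lim: "X \<longlonglongrightarrow> 0" and Z_lim: "Z \<longlonglongrightarrow> 0"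
    using summable_LIMSEQ_zero[OF sum_X] summable_LIMSEQ_zero[OF sum_Z]
    by (auto dest: LIMSEQ_offset)
  have "(\<lambda>k. L * Y (k + T) / L) \<longlonglongrightarrow> 0 / L"
    by (intro tendsto_divide summable_LIMSEQ_zero sum_Y tendsto_const) (use L_pos in simp)
  then have "(\<lambda>k. Y (k + T)) \<longlonglongrightarrow> 0" using L_pos by simp
  then have Y_lim: "Y \<longlonglongrightarrow> 0" by (rule LIMSEQ_offset)
  have sqrt_lim: "(\<lambda>k. norm (z k)) \<longlonglongrightarrow> 0" if "(\<lambda>k. (norm (z k))\<^sup>2) \<longlonglongrightarrow> 0"
    for z :: "nat \<Rightarrow> 'z::real_normed_vector"
    using tendsto_real_sqrt[OF that] by simp
  have dis_lim: "(\<lambda>k. norm (block (z k) i - block_mean (z k))) \<longlonglongrightarrow> 0"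
    if "(\<lambda>k. (norm (disagreement (z k)))\<^sup>2) \<longlonglongrightarrow> 0" for z :: "nat \<Rightarrow> real^('m \<times> 'd)" and i
    by (rule tendsto_sandwich[OF _ _ tendsto_const sqrt_lim[OF that]])
      (auto intro!: always_eventually norm_block_le[of "disagreement _", simplified])
  obtain v where v: "(\<lambda>k. V (k + T)) \<longlonglongrightarrow> v" using conv_V by (auto simp: convergent_def)
  have "V \<longlonglongrightarrow> v" by (rule LIMSEQ_offset[OF v])
  then have "(\<lambda>k. V k - a * X k - b * Z k) \<longlonglongrightarrow> v - a * 0 - b * 0"
    by (intro tendsto_intros X_lim Z_lim)
  then have "(\<lambda>k. \<Phi> k + F \<theta>opt) \<longlonglongrightarrow> v + F \<theta>opt"
    by (intro tendsto_add tendsto_const) (simp add: V_def)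
  then have F_conv: "convergent (\<lambda>k. F (xm k))"
    by (auto simp: \<Phi>_def convergent_def)
  have x_dis: "(\<lambda>k. norm (block (x k) i - xm k)) \<longlonglongrightarrow> 0" for i
    unfolding xm_def by (rule dis_lim) (use X_lim in \<open>simp add: X_def[abs_def]\<close>)
  have y_dis: "(\<lambda>k. norm (block (y k) i - ym k)) \<longlonglongrightarrow> 0" for i
    unfolding ym_def by (rule dis_lim) (use Z_lim in \<open>simp add: Z_def[abs_def]\<close>)
  have ym_lim: "(\<lambda>k. norm (ym k)) \<longlonglongrightarrow> 0"
    by (rule sqrt_lim) (use Y_lim in \<open>simp add: Y_def[abs_def]\<close>)

  \<comment> \<open>the weight \<open>l k\<close> in the arithmetic-geometric mean inequality splits the increment into
    exactly the terms that are known to be summable\<close>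
  have N_inc: "\<bar>N (Suc k) - N k\<bar> \<le> l k * N k + L\<^sup>2 * (Y k / l k) + L\<^sup>2 * Y k" for k
  proof (cases "l k = 0")
    case True
    then have "ym k = 0" using Y_zero by (simp add: Y_def)
    with True show ?thesis by (simp add: N_def xm_Suc Y_def)
  next
    case False
    let ?n = "norm (gradient F (xm k))" and ?n' = "norm (gradient F (xm (Suc k)))"
    have d: "\<bar>?n' - ?n\<bar> \<le> L * norm (ym k)"
      using F_smooth[of "xm (Suc k)" "xm k"] norm_triangle_ineq3[of "gradient F (xm (Suc k))" "gradient F (xm k)"]
      by (simp add: xm_Suc)
    have "N (Suc k) - N k = (?n' - ?n) * (2 * ?n) + (?n' - ?n)\<^sup>2"
      by (simp add: N_def power2_eq_square algebra_simps)
    then have "\<bar>N (Suc k) - N k\<bar> \<le> \<bar>?n' - ?n\<bar> * (2 * ?n) + \<bar>?n' - ?n\<bar>\<^sup>2"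
      using abs_triangle_ineq[of "(?n' - ?n) * (2 * ?n)" "(?n' - ?n)\<^sup>2"] by (simp add: abs_mult)
    also have "\<dots> \<le> L * norm (ym k) * (2 * ?n) + (L * norm (ym k))\<^sup>2"
      using d by (intro add_mono mult_right_mono power_mono) auto
    also have "L * norm (ym k) * (2 * ?n) \<le> l k * N k + L\<^sup>2 * (Y k / l k)"
    proof -
      have "0 \<le> (l k * ?n - L * norm (ym k))\<^sup>2 / l k" using l0 by simp
      also have "\<dots> = l k * N k + L\<^sup>2 * (Y k / l k) - L * norm (ym k) * (2 * ?n)"
        using False by (simp add: N_def Y_def power2_eq_square field_simps)
      finally show ?thesis by simp
    qed
    finally show ?thesis by (simp add: Y_def power_mult_distrib)
  qed
  have "convergent (\<lambda>k. N (k + T))"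
  proof (rule summable_increments_convergent)
    have "summable (\<lambda>k. L * (L * Y (k + T)))" by (rule summable_mult[OF sum_Y])
    then show "summable (\<lambda>k. l (k + T) * N (k + T) + L\<^sup>2 * (Y (k + T) / l (k + T)) + L\<^sup>2 * Y (k + T))"
      using L_pos by (intro summable_add sum_N summable_mult sum_Yl) (simp add: power2_eq_square mult.assoc)
  qed (use N_inc in simp)
  moreover have "\<not> summable (\<lambda>k. l (k + T))"
  proof
    assume sum_l: "summable (\<lambda>k. l (k + T))"
    let ?S = "\<Sum>k. l (k + T)"
    obtain n where n: "\<And>j. n \<le> j \<Longrightarrow> ?S + 1 \<le> (\<Sum>k=T..j. l k)"
      using sum_mean unfolding filterlim_at_top eventually_sequentially l_def by blast
    have "(\<Sum>k=0+T..n+T. l k) = (\<Sum>k=0..n. l (k + T))"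
      by (rule sum.shift_bounds_cl_nat_ivl)
    also have "\<dots> \<le> ?S"
      by (rule sum_le_suminf[OF sum_l]) (simp_all add: l0)
    finally show False using n[of "n + T"] by simp
  qed
  ultimately have "(\<lambda>k. N (k + T)) \<longlonglongrightarrow> 0"
    using sum_N l0 N0 by (intro weighted_summable_limit_zero[where l = "\<lambda>k. l (k + T)"]) auto
  then have "N \<longlonglongrightarrow> 0" by (rule LIMSEQ_offset)
  then have N_lim: "(\<lambda>k. norm (gradient F (xm k))) \<longlonglongrightarrow> 0"
    by (intro sqrt_lim) (simp add: N_def[abs_def])

  have bounded_case: "(\<forall>p. (\<exists>s. strict_mono s \<and> (\<lambda>n. xm (s n)) \<longlonglongrightarrow> p) \<longrightarrow> (\<forall>\<theta>. F p \<le> F \<theta>))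
      \<and> (\<forall>i. (\<lambda>k. F (block (x k) i)) \<longlonglongrightarrow> F \<theta>opt)" if bd: "bounded (range xm)"
  proof -
    obtain R where R: "\<And>k. norm (xm k) \<le> R" using bd by (auto simp: bounded_iff)
    \<comment> \<open>a bounded mean turns a vanishing gradient into a vanishing gap, by convexity\<close>
    have gap: "\<Phi> k \<le> norm (gradient F (xm k)) * (R + norm \<theta>opt)" for k
    proof -
      have "F (xm k) + gradient F (xm k) \<bullet> (\<theta>opt - xm k) \<le> F \<theta>opt"
        using convex_on_objective[of f] convex
        by (intro convex_above_tangent F_diff) (simp add: F_def)
      then have "\<Phi> k \<le> gradient F (xm k) \<bullet> (xm k - \<theta>opt)"
        by (simp add: \<Phi>_def inner_diff_right)
      also have "\<dots> \<le> norm (gradient F (xm k)) * norm (xm k - \<theta>opt)"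
        by (rule norm_cauchy_schwarz)
      also have "\<dots> \<le> norm (gradient F (xm k)) * (R + norm \<theta>opt)"
        using R[of k] norm_triangle_ineq4[of "xm k" \<theta>opt] by (intro mult_left_mono) auto
      finally show ?thesis .
    qed
    have gap_lim: "(\<lambda>k. norm (gradient F (xm k)) * (R + norm \<theta>opt)) \<longlonglongrightarrow> 0"
      by (rule tendsto_mult_left_zero[OF N_lim])
    have \<Phi>_lim: "\<Phi> \<longlonglongrightarrow> 0"
      by (rule tendsto_sandwich[OF _ _ tendsto_const gap_lim])
        (use gap \<Phi>0 in \<open>auto intro!: always_eventually\<close>)
    then have F_lim: "(\<lambda>k. F (xm k)) \<longlonglongrightarrow> F \<theta>opt"
      by (simp add: \<Phi>_def[abs_def] LIM_zero_iff)
    have "F p \<le> F \<theta>" if s: "strict_mono s" "(\<lambda>n. xm (s n)) \<longlonglongrightarrow> p" for s p \<theta>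
    proof -
      have "isCont F p" by (rule differentiable_imp_continuous_within[OF F_diff])
      then have "(\<lambda>n. F (xm (s n))) \<longlonglongrightarrow> F p" using s(2) by (rule isCont_tendsto_compose)
      moreover have "(\<lambda>n. F (xm (s n))) \<longlonglongrightarrow> F \<theta>opt"
        using LIMSEQ_subseq_LIMSEQ[OF F_lim s(1)] by (simp add: o_def)
      ultimately have "F p = F \<theta>opt" by (rule LIMSEQ_unique)
      then show ?thesis using F_min by simp
    qed
    moreover have "(\<lambda>k. F (block (x k) i)) \<longlonglongrightarrow> F \<theta>opt" for i
    proof -
      let ?e = "\<lambda>k. norm (block (x k) i - xm k)"
      let ?u = "\<lambda>k. F (xm k) + norm (gradient F (xm k)) * ?e k + L / 2 * (?e k)\<^sup>2"
      have "F (block (x k) i) \<le> ?u k" for k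
        using smooth_upper_bound[OF F_diff F_smooth, of "block (x k) i" "xm k"]
          norm_cauchy_schwarz[of "gradient F (xm k)" "block (x k) i - xm k"] by linarith
      moreover have "?u \<longlonglongrightarrow> F \<theta>opt + 0 * 0 + L / 2 * 0\<^sup>2"
        by (intro tendsto_intros F_lim N_lim x_dis)
      ultimately show ?thesis
        using F_min tendsto_sandwich[of "\<lambda>_. F \<theta>opt" "\<lambda>k. F (block (x k) i)" sequentially ?u "F \<theta>opt"]
        by simp
    qed
    ultimately show ?thesis by blast
  qed
  show ?thesis
    using F_conv ym_lim x_dis y_dis N_lim bounded_case
    unfolding F_def xm_def[abs_def] y_def ym_def[abs_def] by blast
qed

end
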